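(* Let $a>0$, $b>1$, let $x_t\sim CSA(a,b)$, and let $p\ge 1$ be an integer. Write $$\gamma(k)=\gamma_{CSA(a,b)}(k)=\frac{B(a+k/2,b-1)}{B(a,b-1)},\qquad k=0,1,2,\dots$$ for the autocorrelation function of $x_t$. Consider the $AR(p)$ model $(1-\alpha_1L-\alpha_2L^2-\cdots-\alpha_pL^p)x_t=u_t$ fitted to $x_t$, i.e. let $\alpha_1,\dots,\alpha_p$ be the coefficients minimizing $\operatorname{Var}(u_t)$. Then $$\begin{bmatrix}\alpha_1\\ \alpha_2\\ \vdots\\ \alpha_p\end{bmatrix}=\begin{bmatrix}1&\gamma(1)&\cdots&\gamma(p-1)\\ \gamma(1)&1&\cdots&\gamma(p-2)\\ \vdots&\vdots&\ddots&\vdots\\ \gamma(p-1)&\gamma(p-2)&\cdots&1\end{bmatrix}^{-1}\begin{bmatrix}\gamma(1)\\ \gamma(2)\\ \vdots\\ \gamma(p)\end{bmatrix}.$$ Furthermore, the one-step ahead forecast error variance relative to the minimum square error forecasts, $\zeta_{AR(p)}=\operatorname{Var}(u_t)/\sigma_\epsilon^2$, is given by $$\zeta_{AR(p)}=\left(\frac{B(a,b-1)}{B(a,b)}\right)\left[\left(1+\sum_{i=1}^{p}\alpha_i^2\right)+2\sum_{i=1}^{p}\gamma(i)\left(-\alpha_i+\sum_{j=1}^{p-i}\alpha_j\alpha_{j+i}\right)\right].$$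
   Context: $B(\cdot,\cdot)$ is the Beta function and $L$ is the lag operator, $Lx_t=x_{t-1}$. Cross-sectional aggregation: $x_t\sim CSA(a,b)$ denotes the stationary zero-mean process obtained (as $N\to\infty$) from $x_t=N^{-1/2}\sum_{i=1}^N x_{i,t}$, where $x_{i,t}=\alpha^{(i)} x_{i,t-1}+\epsilon_{i,t}$ are stationary AR(1) series, the $\epsilon_{i,t}$ are i.i.d. with mean zero and variance $\sigma_\epsilon^2>0$, and the $\alpha^{(i)}\in(0,1)$ are i.i.d., independent of the errors, with $(\alpha^{(i)})^2$ drawn from the Beta distribution with density $\frac{1}{B(a,b)}u^{a-1}(1-u)^{b-1}$ on $(0,1)$. For $b>1$ its autocovariance function is $E[x_tx_{t+k}]=\sigma_\epsilon^2\,B(a+|k|/2,b-1)/B(a,b)$, $k\in\mathbb{Z}$. The one-step ahead forecast error variance of the minimum square error forecasts, used as the benchmark, is taken to be $\sigma_\epsilon^2$ (the innovation variance in the moving-average representation $x_t=\sum_{j\ge0}\phi_j\nu_{t-j}$, $\phi_0=1$, $\nu_t$ i.i.d. $N(0,\sigma_\epsilon^2)$, on which those forecasts are based). An empty sum is zero. *)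

theory Defs
  imports "HOL-Probability.Probability" "Jordan_Normal_Form.Matrix"
begin

definition strictly_stationary :: "'w measure \<Rightarrow> (int \<Rightarrow> 'w \<Rightarrow> real) \<Rightarrow> bool" where
  "strictly_stationary M x \<longleftrightarrow>
     (\<forall>h. distr M (Pi\<^sub>M UNIV (\<lambda>_. borel)) (\<lambda>\<omega> t. x (t + h) \<omega>)
        = distr M (Pi\<^sub>M UNIV (\<lambda>_. borel)) (\<lambda>\<omega> t. x t \<omega>))"

definition beta_density :: "real \<Rightarrow> real \<Rightarrow> real \<Rightarrow> real" where
  "beta_density a b u =
     (if 0 < u \<and> u < 1 then u powr (a - 1) * (1 - u) powr (b - 1) / Beta a b else 0)"

text \<open>
  The panel of AR(1) series with random coefficients: \<open>A i\<close> is the autoregressive coefficient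
  and \<open>e i t\<close> the error of the \<open>i\<close>-th series \<open>X i\<close>. The single family in \<open>independent\<close> states
  at once that the coefficients are independent, that the errors are independent (over \<open>i\<close>
  and \<open>t\<close>), and that the coefficients are independent of the errors. The coefficients are
  identically distributed because their squares are and they are positive.
\<close>

locale ar1_panel = prob_space M
  for M :: "'w measure" +
  fixes a b \<sigma> :: real
    and A :: "nat \<Rightarrow> 'w \<Rightarrow> real"
    and e :: "nat \<Rightarrow> int \<Rightarrow> 'w \<Rightarrow> real"
    and X :: "nat \<Rightarrow> int \<Rightarrow> 'w \<Rightarrow> real"
  assumes sigma_pos: "\<sigma> > 0"
    and independent:
      "indep_vars (\<lambda>_. borel) (case_sum A (\<lambda>(i, t). e i t)) (UNIV :: (nat + nat \<times> int) set)"
    and error_identically_distributed: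
      "distr M borel (e i t) = distr M borel (e j s)"
    and error_square_integrable: "integrable M (\<lambda>\<omega>. (e i t \<omega>)\<^sup>2)"
    and error_mean: "expectation (e i t) = 0"
    and error_variance: "variance (e i t) = \<sigma>\<^sup>2"
    and coeff_range: "AE \<omega> in M. 0 < A i \<omega> \<and> A i \<omega> < 1"
    and coeff_square_beta:
      "distributed M lborel (\<lambda>\<omega>. (A i \<omega>)\<^sup>2) (\<lambda>u. ennreal (beta_density a b u))"
    and series_measurable: "random_variable borel (X i t)"
    and series_recursion: "AE \<omega> in M. X i t \<omega> = A i \<omega> * X i (t - 1) \<omega> + e i t \<omega>"
    and series_stationary: "strictly_stationary M (X i)"

definition aggregate :: "(nat \<Rightarrow> int \<Rightarrow> 'w \<Rightarrow> real) \<Rightarrow> nat \<Rightarrow> int \<Rightarrow> 'w \<Rightarrow> real" where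
  "aggregate X N t \<omega> = (\<Sum>i<N. X i t \<omega>) / sqrt (real N)"

text \<open>
  Convergence in law of processes indexed by the integers, as random elements of the type
  \<open>int \<Rightarrow> real\<close> with its product topology. For this topology it is the same as convergence of
  all finite-dimensional distributions. The limit may live on another probability space.
\<close>

definition converges_in_law ::
    "'w measure \<Rightarrow> (nat \<Rightarrow> int \<Rightarrow> 'w \<Rightarrow> real) \<Rightarrow> 'v measure \<Rightarrow> (int \<Rightarrow> 'v \<Rightarrow> real) \<Rightarrow> bool" where
  "converges_in_law P Y M x \<longleftrightarrow>
     (\<forall>f :: (int \<Rightarrow> real) \<Rightarrow> real. continuous_on UNIV f \<longrightarrow> bounded (range f) \<longrightarrow>
        (\<lambda>N. \<integral>\<omega>. f (\<lambda>t. Y N t \<omega>) \<partial>P) \<longlonglongrightarrow> (\<integral>\<omega>. f (\<lambda>t. x t \<omega>) \<partial>M))"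

text \<open>
  The process \<open>x\<close> on the probability space \<open>M\<close> is CSA(a,b): the limit in law of the aggregates
  of a panel. That it is stationary, centred, square integrable, and has autocovariances
  \<open>\<sigma>\<^sup>2 * Beta (a + \<bar>k\<bar> / 2) (b - 1) / Beta a b\<close> for \<open>b > 1\<close> is not assumed; it follows from the
  construction.
\<close>

definition CSA_process ::
    "real \<Rightarrow> real \<Rightarrow> real \<Rightarrow>
     'w measure \<Rightarrow> (nat \<Rightarrow> 'w \<Rightarrow> real) \<Rightarrow> (nat \<Rightarrow> int \<Rightarrow> 'w \<Rightarrow> real) \<Rightarrow> (nat \<Rightarrow> int \<Rightarrow> 'w \<Rightarrow> real) \<Rightarrow>
     'v measure \<Rightarrow> (int \<Rightarrow> 'v \<Rightarrow> real) \<Rightarrow> bool" where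
  "CSA_process a b \<sigma> P A e X M x \<longleftrightarrow>
     ar1_panel P a b \<sigma> A e X \<and>
     prob_space M \<and> (\<forall>t. x t \<in> borel_measurable M) \<and>
     converges_in_law P (aggregate X) M x"

definition \<gamma>_CSA :: "real \<Rightarrow> real \<Rightarrow> nat \<Rightarrow> real" where
  "\<gamma>_CSA a b k = Beta (a + real k / 2) (b - 1) / Beta a (b - 1)"

definition AR_residual ::
    "(int \<Rightarrow> 'v \<Rightarrow> real) \<Rightarrow> nat \<Rightarrow> (nat \<Rightarrow> real) \<Rightarrow> int \<Rightarrow> 'v \<Rightarrow> real" where
  "AR_residual x p \<alpha> t \<omega> = x t \<omega> - (\<Sum>i = 1..p. \<alpha> i * x (t - int i) \<omega>)"

text \<open>Only the values \<open>\<alpha> 1, \<dots>, \<alpha> p\<close> matter; the other values of \<open>\<alpha>\<close> are unconstrained.\<close>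

definition AR_fit ::
    "'v measure \<Rightarrow> (int \<Rightarrow> 'v \<Rightarrow> real) \<Rightarrow> nat \<Rightarrow> int \<Rightarrow> (nat \<Rightarrow> real) \<Rightarrow> bool" where
  "AR_fit M x p t \<alpha> \<longleftrightarrow>
     is_arg_min (\<lambda>\<beta>. prob_space.variance M (AR_residual x p \<beta> t)) (\<lambda>_. True) \<alpha>"

definition \<zeta>_AR ::
    "'v measure \<Rightarrow> real \<Rightarrow> (int \<Rightarrow> 'v \<Rightarrow> real) \<Rightarrow> nat \<Rightarrow> (nat \<Rightarrow> real) \<Rightarrow> int \<Rightarrow> real" where
  "\<zeta>_AR M \<sigma> x p \<alpha> t = prob_space.variance M (AR_residual x p \<alpha> t) / \<sigma>\<^sup>2"

definition autocorrelation_mat :: "(nat \<Rightarrow> real) \<Rightarrow> nat \<Rightarrow> real mat" where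
  "autocorrelation_mat \<gamma> p =
     Matrix.mat p p (\<lambda>(i, j). if i = j then 1 else \<gamma> (nat \<bar>int i - int j\<bar>))"

text \<open>Matrix and vector indices start at 0, so entry \<open>i\<close> holds \<open>f (i + 1)\<close>.\<close>

definition vec_from_1 :: "(nat \<Rightarrow> real) \<Rightarrow> nat \<Rightarrow> real Matrix.vec" where
  "vec_from_1 f p = Matrix.vec p (\<lambda>i. f (i + 1))"

end

theory Submission
  imports Defs "Jordan_Normal_Form.Determinant"
begin

text \<open>
  An AR residual of \<open>x\<close> is a linear combination of finitely many values of \<open>x\<close>. Once the variance of such
  a combination with coefficients \<open>c\<close> is known to be
  \<open>\<sigma>\<^sup>2 * (Beta a (b - 1) / Beta a b)\<close> times the Toeplitz form \<open>\<Sum>s s'. c s * c s' * \<gamma> \<bar>s - s'\<bar>\<close>, and this form to be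
  positive definite, the theorem is linear algebra: completing the square at a solution of the normal
  equations shows that it is the only minimiser (\<open>arg_min_prediction_error_iff\<close>), positive
  definiteness makes the autocorrelation matrix invertible (\<open>autocorrelation_mat_invertible\<close>), and
  collecting the form by lags (\<open>lag_form_by_lags\<close>) is the formula for the relative forecast error
  variance.

  The variance has to be found for a process that is only given as a limit in law of aggregates,
  and limits in law need not preserve variances. The central limit theorem supplies the missing
  information. A linear combination of the aggregates is \<open>N powr (-1/2)\<close> times a sum of \<open>N\<close>
  independent copies of \<open>Y = (\<Sum>s\<le>p. c s * X i (t - s))\<close>. It converges in law to a centred normal variable with
  variance \<open>E Y\<^sup>2\<close>, and it also converges in law to the combination of the limit process. So the latter is
  normal with this variance (\<open>CSA_combination_normal\<close>, \<open>CSA_combination_variance\<close>).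

  For the central limit theorem the filtered series must be independent and identically
  distributed over \<open>i\<close>. The assumptions on the panel link a series to its coefficient and errors
  through the recursion only. Iterating it gives
  \<open>X i t = A i ^ n * X i (t - n) + (\<Sum>j<n. A i ^ j * e i (t - j))\<close>, and the first term vanishes in the limit because all
  \<open>X i (t - n)\<close> have the same law. Hence \<open>X i t = (\<Sum>j. A i ^ j * e i (t - j))\<close> almost surely
  (\<open>series_moving_average\<close>), and \<open>Y\<close> is a function of the coefficient and the errors of its own
  series.

  Finally \<open>Y = (\<Sum>j. w j (A i) * e i (t - j))\<close> is an orthogonal series, so that
  \<open>E Y\<^sup>2 = \<sigma>\<^sup>2 * (\<Sum>j. E (w j (A i))\<^sup>2)\<close> by Parseval's identity (\<open>orthogonal_series_second_moment\<close>). Summing the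
  geometric series in \<open>A i\<close> leaves the expectations of \<open>A i ^ k / (1 - (A i)\<^sup>2)\<close>, which are the Beta quotients of the
  autocovariances (\<open>coeff_moment\<close>). Being a positive multiple of a sum of expected squares, one of which is the square of the first
  nonzero coefficient of \<open>c\<close>, the form is positive definite (\<open>toeplitz_form_\<gamma>_CSA_pos\<close>).
\<close>

section \<open>Linear filters of an AR(1) series\<close>

text \<open>
  The impulse response of the filter \<open>c 0 + c 1 L + \<dots> + c p L^p\<close> applied to an AR(1) series with
  coefficient \<open>\<alpha>\<close>: the weight of the error of \<open>j\<close> periods ago.
\<close>

definition response_weight :: "(nat \<Rightarrow> real) \<Rightarrow> nat \<Rightarrow> real \<Rightarrow> nat \<Rightarrow> real" where
  "response_weight c p \<alpha> j = (\<Sum>s\<le>p. if s \<le> j then c s * \<alpha> ^ (j - s) else 0)"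

lemma sums_delayed:
  fixes f :: "nat \<Rightarrow> real"
  assumes "f sums L"
  shows "(\<lambda>j. if s \<le> j then f (j - s) else 0) sums L"
proof -
  let ?g = "\<lambda>j. if s \<le> j then f (j - s) else 0"
  have "(\<lambda>j. ?g (j + s)) sums L" using assms by simp
  then show ?thesis by (subst (asm) sums_iff_shift) simp
qed

lemma combination_of_filters_sums:
  fixes \<epsilon> z :: "int \<Rightarrow> real"
  assumes "\<And>t. (\<lambda>j. \<alpha> ^ j * \<epsilon> (t - int j)) sums z t"
  shows "(\<lambda>j. response_weight c p \<alpha> j * \<epsilon> (t - int j)) sums (\<Sum>s\<le>p. c s * z (t - int s))"
proof -
  have "(\<lambda>j. c s * (if s \<le> j then \<alpha> ^ (j - s) * \<epsilon> (t - int s - int (j - s)) else 0)) sums (c s * z (t - int s))" for s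
    using sums_mult[OF sums_delayed[OF assms[of "t - int s"], of s], of "c s"] .
  then have *: "(\<lambda>j. \<Sum>s\<le>p. c s * (if s \<le> j then \<alpha> ^ (j - s) * \<epsilon> (t - int s - int (j - s)) else 0))
      sums (\<Sum>s\<le>p. c s * z (t - int s))"
    by (intro sums_sum) auto
  show ?thesis
    by (rule iffD1[OF sums_cong *], unfold response_weight_def sum_distrib_right, rule sum.cong)
       (auto simp: of_nat_diff)
qed

text \<open>
  The sum of squares of the impulse response is the quadratic form with the AR(1)
  autocovariances as kernel. For \<open>s \<le> s'\<close> the lagged responses overlap from \<open>j = s'\<close> on, where their
  product is \<open>\<alpha> ^ (s' - s)\<close> times the geometric term \<open>(\<alpha>\<^sup>2) ^ (j - s')\<close>.
\<close>

lemma response_weight_square_sums: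
  assumes "\<bar>\<alpha>\<bar> < 1"
  shows "(\<lambda>j. (response_weight c p \<alpha> j)\<^sup>2) sums
    (\<Sum>s\<le>p. \<Sum>s'\<le>p. c s * c s' * (\<alpha> ^ nat \<bar>int s - int s'\<bar> / (1 - \<alpha>\<^sup>2)))"
proof -
  have geo: "(\<lambda>j. \<alpha> ^ k * (\<alpha>\<^sup>2) ^ j) sums (\<alpha> ^ k * (1 / (1 - \<alpha>\<^sup>2)))" for k
    using assms by (intro sums_mult geometric_sums) (simp add: abs_square_less_1)
  have step: "(\<lambda>j. (if s \<le> j then \<alpha> ^ (j - s) else 0) * (if s' \<le> j then \<alpha> ^ (j - s') else 0)) sums
      (\<alpha> ^ nat \<bar>int s - int s'\<bar> / (1 - \<alpha>\<^sup>2))" if "s \<le> s'" for s s'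
  proof -
    have "\<alpha> ^ (s' - s) * (\<alpha>\<^sup>2) ^ (j - s') = \<alpha> ^ (j - s) * \<alpha> ^ (j - s')" if "s' \<le> j" for j
    proof -
      have "j - s = (s' - s) + (j - s')" using that \<open>s \<le> s'\<close> by simp
      then have "\<alpha> ^ (j - s) = \<alpha> ^ (s' - s) * \<alpha> ^ (j - s')"
        by (metis power_add)
      then show ?thesis by (simp add: power2_eq_square power_mult_distrib)
    qed
    moreover have "nat \<bar>int s - int s'\<bar> = s' - s" using that by simp
    ultimately show ?thesis
      using sums_delayed[OF geo[of "s' - s"], of s'] that
      by (subst sums_cong[where g = "\<lambda>j. if s' \<le> j then \<alpha> ^ (s' - s) * (\<alpha>\<^sup>2) ^ (j - s') else 0"]) auto
  qed
  have "(\<lambda>j. (if s \<le> j then \<alpha> ^ (j - s) else 0) * (if s' \<le> j then \<alpha> ^ (j - s') else 0)) sums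
      (\<alpha> ^ nat \<bar>int s - int s'\<bar> / (1 - \<alpha>\<^sup>2))" for s s'
    using step[of s s'] step[of s' s] by (cases "s \<le> s'") (auto simp: abs_minus_commute mult.commute)
  then have "(\<lambda>j. \<Sum>s\<le>p. \<Sum>s'\<le>p. c s * c s' * ((if s \<le> j then \<alpha> ^ (j - s) else 0) * (if s' \<le> j then \<alpha> ^ (j - s') else 0))) sums
      (\<Sum>s\<le>p. \<Sum>s'\<le>p. c s * c s' * (\<alpha> ^ nat \<bar>int s - int s'\<bar> / (1 - \<alpha>\<^sup>2)))"
    by (intro sums_sum sums_mult) 
  moreover have "(\<Sum>s\<le>p. \<Sum>s'\<le>p. c s * c s' * ((if s \<le> j then \<alpha> ^ (j - s) else 0) * (if s' \<le> j then \<alpha> ^ (j - s') else 0)))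
     = (response_weight c p \<alpha> j)\<^sup>2" for j
    unfolding response_weight_def power2_eq_square sum_product
    by (intro sum.cong) auto
  ultimately show ?thesis by simp
qed

text \<open>
  The first nonzero coefficient of a filter reappears, free of \<open>\<alpha>\<close>, among the weights. This is
  what keeps the variance of a nontrivial filter away from zero.
\<close>

lemma response_weight_first:
  assumes "\<And>s. s < m \<Longrightarrow> c s = 0" "m \<le> p"
  shows "response_weight c p \<alpha> m = c m"
proof -
  have "response_weight c p \<alpha> m = (\<Sum>s\<le>p. if s = m then c s else 0)"
    unfolding response_weight_def using assms by (intro sum.cong) (auto simp: not_le)
  then show ?thesis using assms by simp
qed

section \<open>Orthogonal series and vanishing remainders\<close>

text \<open>
  Parseval's identity for a series that is only known to converge almost surely. Fatou's lemma
  bounds the second moment of the remainder \<open>Y - S n\<close> by the tail \<open>r n\<close> of the series of second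
  moments, so that the convergence also holds in mean square.
\<close>

lemma (in prob_space) orthogonal_series_second_moment:
  fixes f :: "nat \<Rightarrow> 'a \<Rightarrow> real" and Y :: "'a \<Rightarrow> real"
  assumes rv [measurable]: "\<And>j. random_variable borel (f j)" "random_variable borel Y"
    and int: "\<And>j k. integrable M (\<lambda>\<omega>. f j \<omega> * f k \<omega>)"
    and mean: "\<And>j. expectation (f j) = 0"
    and orth: "\<And>j k. j \<noteq> k \<Longrightarrow> expectation (\<lambda>\<omega>. f j \<omega> * f k \<omega>) = 0"
    and conv: "AE \<omega> in M. (\<lambda>j. f j \<omega>) sums Y \<omega>"
    and v: "(\<lambda>j. expectation (\<lambda>\<omega>. (f j \<omega>)\<^sup>2)) sums v"
  shows "integrable M (\<lambda>\<omega>. (Y \<omega>)\<^sup>2)" "expectation (\<lambda>\<omega>. (Y \<omega>)\<^sup>2) = v" "expectation Y = 0"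
proof -
  define S where "S n \<omega> = (\<Sum>j<n. f j \<omega>)" for n \<omega>
  define r where "r n = v - (\<Sum>j<n. expectation (\<lambda>\<omega>. (f j \<omega>)\<^sup>2))" for n
  have [measurable]: "random_variable borel (S n)" for n unfolding S_def by measurable
  have pythagoras: "integrable M (\<lambda>\<omega>. (\<Sum>j\<in>I. f j \<omega>)\<^sup>2) \<and>
      expectation (\<lambda>\<omega>. (\<Sum>j\<in>I. f j \<omega>)\<^sup>2) = (\<Sum>j\<in>I. expectation (\<lambda>\<omega>. (f j \<omega>)\<^sup>2))"
    if "finite I" for I
  proof
    show "integrable M (\<lambda>\<omega>. (\<Sum>j\<in>I. f j \<omega>)\<^sup>2)"
      unfolding power2_eq_square sum_product by (intro Bochner_Integration.integrable_sum int)
    have "expectation (\<lambda>\<omega>. (\<Sum>j\<in>I. f j \<omega>)\<^sup>2) = (\<Sum>j\<in>I. \<Sum>k\<in>I. expectation (\<lambda>\<omega>. f j \<omega> * f k \<omega>))"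
      unfolding power2_eq_square sum_product
      by (simp add: Bochner_Integration.integral_sum Bochner_Integration.integrable_sum int)
    also have "\<dots> = (\<Sum>j\<in>I. \<Sum>k\<in>I. if j = k then expectation (\<lambda>\<omega>. (f j \<omega>)\<^sup>2) else 0)"
      by (intro sum.cong) (auto simp: orth power2_eq_square)
    finally show "expectation (\<lambda>\<omega>. (\<Sum>j\<in>I. f j \<omega>)\<^sup>2) = (\<Sum>j\<in>I. expectation (\<lambda>\<omega>. (f j \<omega>)\<^sup>2))"
      using that by simp
  qed
  have r_lim: "r \<longlonglongrightarrow> 0"
    using tendsto_diff[OF tendsto_const[of v] v[unfolded sums_def]] by (simp add: r_def[abs_def])
  have r_nonneg: "0 \<le> r n" for n
    using sum_le_suminf[OF sums_summable[OF v], of "{..<n}"] sums_unique[OF v] by (simp add: r_def)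
  have remainder: "(\<integral>\<^sup>+\<omega>. ennreal ((Y \<omega> - S n \<omega>)\<^sup>2) \<partial>M) \<le> ennreal (r n)" for n
  proof -
    have "(\<integral>\<^sup>+\<omega>. ennreal ((Y \<omega> - S n \<omega>)\<^sup>2) \<partial>M) = (\<integral>\<^sup>+\<omega>. liminf (\<lambda>m. ennreal ((S m \<omega> - S n \<omega>)\<^sup>2)) \<partial>M)"
    proof (rule nn_integral_cong_AE, use conv in eventually_elim)
      fix \<omega> assume "(\<lambda>j. f j \<omega>) sums Y \<omega>"
      then have "(\<lambda>m. S m \<omega>) \<longlonglongrightarrow> Y \<omega>" by (simp add: sums_def S_def)
      then have "(\<lambda>m. ennreal ((S m \<omega> - S n \<omega>)\<^sup>2)) \<longlonglongrightarrow> ennreal ((Y \<omega> - S n \<omega>)\<^sup>2)"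
        by (intro tendsto_intros)
      then show "ennreal ((Y \<omega> - S n \<omega>)\<^sup>2) = liminf (\<lambda>m. ennreal ((S m \<omega> - S n \<omega>)\<^sup>2))"
        by (intro lim_imp_Liminf[symmetric]) simp_all
    qed
    also have "\<dots> \<le> liminf (\<lambda>m. \<integral>\<^sup>+\<omega>. ennreal ((S m \<omega> - S n \<omega>)\<^sup>2) \<partial>M)"
      by (intro nn_integral_liminf) auto
    also have "\<dots> \<le> ennreal (r n)"
    proof (rule Liminf_le, simp)
      show "\<forall>\<^sub>F m in sequentially. (\<integral>\<^sup>+\<omega>. ennreal ((S m \<omega> - S n \<omega>)\<^sup>2) \<partial>M) \<le> ennreal (r n)"
        using eventually_ge_at_top[of n]
      proof eventually_elim
        case (elim m)
        have S_diff: "S m \<omega> - S n \<omega> = (\<Sum>j=n..<m. f j \<omega>)" for \<omega>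
          using sum_diff_nat_ivl[of 0 n m "\<lambda>j. f j \<omega>"] elim by (simp add: S_def atLeast0LessThan)
        have "(\<integral>\<^sup>+\<omega>. ennreal ((S m \<omega> - S n \<omega>)\<^sup>2) \<partial>M) = ennreal (\<Sum>j=n..<m. expectation (\<lambda>\<omega>. (f j \<omega>)\<^sup>2))"
          unfolding S_diff using pythagoras[of "{n..<m}"] by (subst nn_integral_eq_integral) auto
        also have "(\<Sum>j=n..<m. expectation (\<lambda>\<omega>. (f j \<omega>)\<^sup>2)) = r n - r m"
          using sum_diff_nat_ivl[of 0 n m "\<lambda>j. expectation (\<lambda>\<omega>. (f j \<omega>)\<^sup>2)"] elim
          by (simp add: r_def atLeast0LessThan)
        finally show ?case using r_nonneg[of m] by (simp add: ennreal_leI)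
      qed
    qed
    finally show ?thesis .
  qed
  have rem_int: "integrable M (\<lambda>\<omega>. (Y \<omega> - S n \<omega>)\<^sup>2)" for n
    using remainder[of n] by (intro integrableI_bounded) (auto simp: le_less_trans)
  have rem_le: "expectation (\<lambda>\<omega>. (Y \<omega> - S n \<omega>)\<^sup>2) \<le> r n" for n
    using remainder[of n] r_nonneg[of n] by (subst (asm) nn_integral_eq_integral[OF rem_int]) auto
  show Y2: "integrable M (\<lambda>\<omega>. (Y \<omega>)\<^sup>2)"
    using rem_int[of 0] by (simp add: S_def)
  let ?m = "expectation (\<lambda>\<omega>. (Y \<omega>)\<^sup>2)"
  \<comment> \<open>Fatou's lemma gives only \<open>?m \<le> v\<close>. For the converse, \<open>S n = Y - (Y - S n)\<close> is
    squared with Young's inequality, and \<open>h\<close> tends to \<open>0\<close> after \<open>n\<close> has tended to infinity.\<close>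
  have "v \<le> (1 + h) * ?m" if "h > 0" for h :: real
  proof (rule LIMSEQ_le)
    show "(\<lambda>n. v - r n) \<longlonglongrightarrow> v" "(\<lambda>n. (1 + h) * ?m + (1 + 1 / h) * r n) \<longlonglongrightarrow> (1 + h) * ?m"
      using tendsto_diff[OF tendsto_const[of v] r_lim]
        tendsto_add[OF tendsto_const[of "(1 + h) * ?m"] tendsto_mult[OF tendsto_const[of "1 + 1 / h"] r_lim]]
      by simp_all
    have "v - r n \<le> (1 + h) * ?m + (1 + 1 / h) * r n" for n
    proof -
      have young: "(S n \<omega>)\<^sup>2 \<le> (1 + h) * (Y \<omega>)\<^sup>2 + (1 + 1 / h) * (Y \<omega> - S n \<omega>)\<^sup>2" for \<omega>
      proof -
        have "0 \<le> (h * Y \<omega> + (Y \<omega> - S n \<omega>))\<^sup>2 / h" using that by simp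
        also have "\<dots> = (1 + h) * (Y \<omega>)\<^sup>2 + (1 + 1 / h) * (Y \<omega> - S n \<omega>)\<^sup>2 - (S n \<omega>)\<^sup>2"
          using that by (simp add: field_simps power2_eq_square)
        finally show ?thesis by simp
      qed
      have "v - r n = expectation (\<lambda>\<omega>. (S n \<omega>)\<^sup>2)"
        using pythagoras[of "{..<n}"] by (simp add: r_def S_def)
      also have "\<dots> \<le> expectation (\<lambda>\<omega>. (1 + h) * (Y \<omega>)\<^sup>2 + (1 + 1 / h) * (Y \<omega> - S n \<omega>)\<^sup>2)"
        using pythagoras[of "{..<n}"] Y2 rem_int[of n] young
        by (intro integral_mono) (auto simp: S_def)
      also have "\<dots> = (1 + h) * ?m + (1 + 1 / h) * expectation (\<lambda>\<omega>. (Y \<omega> - S n \<omega>)\<^sup>2)"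
        using Y2 rem_int[of n] by simp
      also have "\<dots> \<le> (1 + h) * ?m + (1 + 1 / h) * r n"
        using rem_le[of n] that by (intro add_mono mult_left_mono) auto
      finally show ?thesis .
    qed
    then show "\<exists>N. \<forall>n\<ge>N. v - r n \<le> (1 + h) * ?m + (1 + 1 / h) * r n" by blast
  qed
  then have "v \<le> ?m"
  proof -
    assume *: "\<And>h. h > 0 \<Longrightarrow> v \<le> (1 + h) * ?m"
    have "((\<lambda>h. (1 + h) * ?m) \<longlongrightarrow> (1 + 0) * ?m) (at_right 0)"
      by (intro tendsto_intros)
    moreover have "eventually (\<lambda>h. v \<le> (1 + h) * ?m) (at_right 0)"
      using * by (intro eventually_at_rightI[of 0 1]) auto
    ultimately show ?thesis
      using tendsto_lowerbound[of "\<lambda>h. (1 + h) * ?m" ?m "at_right 0" v] by simp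
  qed
  moreover have "?m \<le> v" using rem_le[of 0] by (simp add: S_def r_def)
  ultimately show "?m = v" by simp
  have f_int: "integrable M (f j)" for j
    using int[of j j] unfolding power2_eq_square[symmetric]
    by (rule square_integrable_imp_integrable[OF rv(1)])
  have Y_int: "integrable M Y"
    by (rule square_integrable_imp_integrable[OF rv(2) Y2])
  have S_int: "integrable M (S n)" and S_mean: "expectation (S n) = 0" for n
    using f_int mean by (auto simp: S_def[abs_def])
  \<comment> \<open>Since \<open>S n\<close> has mean zero, \<open>expectation Y\<close> is the mean of the remainder.\<close>
  have "(expectation Y)\<^sup>2 \<le> r n" for n
  proof -
    have "0 \<le> variance (\<lambda>\<omega>. Y \<omega> - S n \<omega>)" by (rule variance_positive)
    also have "\<dots> = expectation (\<lambda>\<omega>. (Y \<omega> - S n \<omega>)\<^sup>2) - (expectation Y)\<^sup>2"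
      using Y_int S_int[of n] S_mean[of n] rem_int[of n] by (subst variance_eq) auto
    finally show ?thesis using rem_le[of n] by simp
  qed
  then have "(expectation Y)\<^sup>2 \<le> 0"
    using LIMSEQ_le_const[OF r_lim] by blast
  then show "expectation Y = 0" by simp
qed

text \<open>
  Identically distributed variables form a tight family, so their product with factors that
  tend to zero almost surely tends to zero in probability; an almost sure limit of the product
  must therefore vanish. Convergence in probability is measured by the expectation
  of the bounded function \<open>g x = min 1 \<bar>x\<bar>\<close>, which allows dominated convergence.
\<close>

lemma tight_times_vanishing_limit_zero:
  fixes R X :: "nat \<Rightarrow> 'w \<Rightarrow> real"
  assumes "prob_space M"
    and [measurable]: "\<And>n. R n \<in> borel_measurable M" "\<And>n. X n \<in> borel_measurable M" "D \<in> borel_measurable M"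
    and same: "\<And>n. distr M borel (X n) = distr M borel (X 0)"
    and R0: "AE \<omega> in M. (\<lambda>n. R n \<omega>) \<longlonglongrightarrow> 0"
    and lim: "AE \<omega> in M. (\<lambda>n. R n \<omega> * X n \<omega>) \<longlonglongrightarrow> D \<omega>"
  shows "AE \<omega> in M. D \<omega> = 0"
proof -
  interpret prob_space M by fact
  define g :: "real \<Rightarrow> real" where "g x = min 1 \<bar>x\<bar>" for x
  have [measurable]: "g \<in> borel_measurable borel" unfolding g_def by measurable
  have g_bounds: "0 \<le> g x" "g x \<le> 1" "norm (g x) \<le> 1" for x by (auto simp: g_def)
  have g_int: "integrable M (\<lambda>\<omega>. g (h \<omega>))" if [measurable]: "h \<in> borel_measurable M" for h
    by (rule integrable_const_bound[where B = 1]) (use g_bounds in auto)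
  have tail: "(\<integral>\<omega>. g (D \<omega>) \<partial>M) \<le> prob {\<omega> \<in> space M. real K < \<bar>X 0 \<omega>\<bar>}" for K :: nat
  proof (rule LIMSEQ_le)
    show "(\<lambda>n. \<integral>\<omega>. g (R n \<omega> * X n \<omega>) \<partial>M) \<longlonglongrightarrow> (\<integral>\<omega>. g (D \<omega>) \<partial>M)"
    proof (rule integral_dominated_convergence[where w = "\<lambda>_. 1"])
      show "AE \<omega> in M. (\<lambda>n. g (R n \<omega> * X n \<omega>)) \<longlonglongrightarrow> g (D \<omega>)"
        using lim by eventually_elim (auto simp: g_def intro!: tendsto_intros)
    qed (use g_bounds in auto)
    have "(\<lambda>n. \<integral>\<omega>. g (R n \<omega> * real K) \<partial>M) \<longlonglongrightarrow> (\<integral>\<omega>. 0 \<partial>M)"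
    proof (rule integral_dominated_convergence[where w = "\<lambda>_. 1"])
      show "AE \<omega> in M. (\<lambda>n. g (R n \<omega> * real K)) \<longlonglongrightarrow> 0"
        using R0
      proof eventually_elim
        case (elim \<omega>)
        have "(\<lambda>n. min 1 \<bar>R n \<omega> * real K\<bar>) \<longlonglongrightarrow> min 1 \<bar>0 * real K\<bar>"
          by (intro tendsto_intros elim)
        then show ?case by (simp add: g_def)
      qed
    qed (use g_bounds in auto)
    from tendsto_add[OF tendsto_const[of "prob {\<omega> \<in> space M. real K < \<bar>X 0 \<omega>\<bar>}"] this]
    show "(\<lambda>n. prob {\<omega> \<in> space M. real K < \<bar>X 0 \<omega>\<bar>} + (\<integral>\<omega>. g (R n \<omega> * real K) \<partial>M))
        \<longlonglongrightarrow> prob {\<omega> \<in> space M. real K < \<bar>X 0 \<omega>\<bar>}" by simp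
    have "(\<integral>\<omega>. g (R n \<omega> * X n \<omega>) \<partial>M) \<le>
        prob {\<omega> \<in> space M. real K < \<bar>X 0 \<omega>\<bar>} + (\<integral>\<omega>. g (R n \<omega> * real K) \<partial>M)" for n
    proof -
      have split: "g (R n \<omega> * X n \<omega>) \<le> indicator {\<omega> \<in> space M. real K < \<bar>X n \<omega>\<bar>} \<omega> + g (R n \<omega> * real K)"
        if "\<omega> \<in> space M" for \<omega>
      proof (cases "real K < \<bar>X n \<omega>\<bar>")
        case True
        then show ?thesis using that g_bounds(1)[of "R n \<omega> * real K"] g_bounds(2)[of "R n \<omega> * X n \<omega>"] by simp
      next
        case False
        then have "\<bar>R n \<omega> * X n \<omega>\<bar> \<le> \<bar>R n \<omega> * real K\<bar>"
          by (auto simp: abs_mult intro!: mult_left_mono)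
        then show ?thesis using False by (simp add: g_def)
      qed
      have "(\<integral>\<omega>. g (R n \<omega> * X n \<omega>) \<partial>M) \<le>
          (\<integral>\<omega>. indicator {\<omega> \<in> space M. real K < \<bar>X n \<omega>\<bar>} \<omega> + g (R n \<omega> * real K) \<partial>M)"
        by (rule integral_mono) (auto intro!: g_int Bochner_Integration.integrable_add split integrable_real_indicator
            simp: emeasure_eq_measure)
      also have "\<dots> = prob {\<omega> \<in> space M. real K < \<bar>X n \<omega>\<bar>} + (\<integral>\<omega>. g (R n \<omega> * real K) \<partial>M)"
        by (subst Bochner_Integration.integral_add)
          (auto intro!: g_int integrable_real_indicator simp: emeasure_eq_measure)
      also have "prob {\<omega> \<in> space M. real K < \<bar>X n \<omega>\<bar>} = measure (distr M borel (X n)) {x. real K < \<bar>x\<bar>}"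
        by (subst measure_distr) (auto intro!: arg_cong[where f = prob])
      also have "\<dots> = prob {\<omega> \<in> space M. real K < \<bar>X 0 \<omega>\<bar>}"
        by (subst same, subst measure_distr) (auto intro!: arg_cong[where f = prob])
      finally show ?thesis .
    qed
    then show "\<exists>N. \<forall>n\<ge>N. (\<integral>\<omega>. g (R n \<omega> * X n \<omega>) \<partial>M) \<le>
        prob {\<omega> \<in> space M. real K < \<bar>X 0 \<omega>\<bar>} + (\<integral>\<omega>. g (R n \<omega> * real K) \<partial>M)" by blast
  qed
  have "(\<lambda>K. prob {\<omega> \<in> space M. real K < \<bar>X 0 \<omega>\<bar>}) \<longlonglongrightarrow> prob (\<Inter>K. {\<omega> \<in> space M. real K < \<bar>X 0 \<omega>\<bar>})"
    by (rule finite_Lim_measure_decseq) (auto simp: decseq_def)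
  moreover have "\<exists>K. \<bar>X 0 \<omega>\<bar> \<le> real K" for \<omega> by (rule real_arch_simple)
  then have "(\<Inter>K. {\<omega> \<in> space M. real K < \<bar>X 0 \<omega>\<bar>}) = {}"
    by (auto simp flip: not_le)
  ultimately have "(\<integral>\<omega>. g (D \<omega>) \<partial>M) \<le> 0"
    using tail by (intro LIMSEQ_le_const[of "\<lambda>K. prob {\<omega> \<in> space M. real K < \<bar>X 0 \<omega>\<bar>}"]) auto
  then have "(\<integral>\<omega>. g (D \<omega>) \<partial>M) = 0"
    using Bochner_Integration.integral_nonneg[of M "\<lambda>\<omega>. g (D \<omega>)"] g_bounds by (intro antisym) auto
  then have "AE \<omega> in M. g (D \<omega>) = 0"
    by (subst (asm) integral_nonneg_eq_0_iff_AE) (auto intro!: g_int g_bounds)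
  then show ?thesis by eventually_elim (auto simp: g_def min_def split: if_splits)
qed

section \<open>The panel series as random-coefficient moving averages\<close>

lemma beta_real_pos:
  fixes a b :: real
  assumes "a > 0" "b > 0"
  shows "Beta a b > 0"
  using assms by (simp add: Beta_def Gamma_real_pos)

lemma strictly_stationary_marginal:
  assumes "strictly_stationary M x" and [measurable]: "\<And>t. x t \<in> borel_measurable M"
  shows "distr M borel (x t) = distr M borel (x s)"
proof -
  have "distr (distr M (Pi\<^sub>M UNIV (\<lambda>_. borel)) (\<lambda>\<omega> r. x (r + h) \<omega>)) borel (\<lambda>f. f s) = distr M borel (x (s + h))"
    for h :: int
    by (subst distr_distr) (auto simp: comp_def intro!: measurable_PiM_single')
  from this[of "t - s"] this[of 0] show ?thesis
    using assms(1) unfolding strictly_stationary_def by simp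
qed

context ar1_panel
begin

lemma coeff_rv [measurable]: "random_variable borel (A i)"
  using independent[unfolded indep_vars_def2, THEN conjunct1, rule_format, of "Inl i"] by simp

lemma error_rv [measurable]: "random_variable borel (e i t)"
  using independent[unfolded indep_vars_def2, THEN conjunct1, rule_format, of "Inr (i, t)"] by simp

declare series_measurable [measurable]

lemma error_integrable: "integrable M (e i t)"
  by (rule square_integrable_imp_integrable[OF error_rv error_square_integrable])

lemma error_second_moment: "expectation (\<lambda>\<omega>. (e i t \<omega>)\<^sup>2) = \<sigma>\<^sup>2"
  using error_variance[of i t] error_mean[of i t] by simp

text \<open>
  For a fixed rate the expected sum is finite because the errors are identically distributed
  and integrable. The countably many rates \<open>q m\<close> tending to \<open>1\<close> dominate all others, so a single null set
  serves every \<open>\<alpha>\<close>; in particular the random \<open>\<alpha> = A i \<omega>\<close> may be inserted.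
\<close>

lemma geometric_error_series_summable:
  "AE \<omega> in M. \<forall>\<alpha> t. 0 \<le> \<alpha> \<and> \<alpha> < 1 \<longrightarrow> summable (\<lambda>j. \<alpha> ^ j * \<bar>e i (t - int j) \<omega>\<bar>)"
proof -
  define q where "q m = 1 - 1 / real (Suc m)" for m
  define C where "C = expectation (\<lambda>\<omega>. \<bar>e i 0 \<omega>\<bar>)"
  have q: "0 \<le> q m" "q m < 1" for m by (auto simp: q_def)
  have C: "expectation (\<lambda>\<omega>. \<bar>e i t \<omega>\<bar>) = C" for t
  proof -
    have "expectation (\<lambda>\<omega>. \<bar>e i t \<omega>\<bar>) = (\<integral>x. \<bar>x\<bar> \<partial>distr M borel (e i t))" for t
      by (subst integral_distr) auto
    then show ?thesis unfolding C_def using error_identically_distributed[of i t i 0] by simp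
  qed
  have "AE \<omega> in M. summable (\<lambda>j. q m ^ j * \<bar>e i (t - int j) \<omega>\<bar>)" for m t
  proof -
    have "(\<integral>\<^sup>+\<omega>. (\<Sum>j. ennreal (q m ^ j * \<bar>e i (t - int j) \<omega>\<bar>)) \<partial>M)
        = (\<Sum>j. \<integral>\<^sup>+\<omega>. ennreal (q m ^ j * \<bar>e i (t - int j) \<omega>\<bar>) \<partial>M)"
      by (rule nn_integral_suminf) auto
    also have "\<dots> = (\<Sum>j. ennreal (q m ^ j * C))"
      using error_integrable q by (intro suminf_cong, subst nn_integral_eq_integral) (auto simp: C)
    also have "\<dots> \<noteq> \<top>"
      using q[of m] by (subst suminf_ennreal2) (auto simp: C_def intro!: summable_mult2 summable_geometric)
    finally have "AE \<omega> in M. (\<Sum>j. ennreal (q m ^ j * \<bar>e i (t - int j) \<omega>\<bar>)) \<noteq> \<infinity>"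
      by (intro nn_integral_PInf_AE) auto
    then show ?thesis
      by eventually_elim (rule summable_suminf_not_top, use q in auto)
  qed
  then have "AE \<omega> in M. \<forall>m t. summable (\<lambda>j. q m ^ j * \<bar>e i (t - int j) \<omega>\<bar>)"
    unfolding AE_all_countable by blast
  then show ?thesis
  proof eventually_elim
    case (elim \<omega>)
    show ?case
    proof (intro allI impI)
      fix \<alpha> :: real and t :: int assume \<alpha>: "0 \<le> \<alpha> \<and> \<alpha> < 1"
      then obtain m where "1 / real (Suc m) < 1 - \<alpha>"
        using nat_approx_posE[of "1 - \<alpha>"] by auto
      then have "\<alpha> \<le> q m" by (simp add: q_def)
      then show "summable (\<lambda>j. \<alpha> ^ j * \<bar>e i (t - int j) \<omega>\<bar>)"
        using \<alpha> by (intro summable_comparison_test'[OF elim[rule_format, of m t], of 0])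
          (auto simp: abs_mult intro!: mult_right_mono power_mono)
    qed
  qed
qed

lemma series_unrolled:
  "AE \<omega> in M. \<forall>t n. X i t \<omega> = A i \<omega> ^ n * X i (t - int n) \<omega> + (\<Sum>j<n. A i \<omega> ^ j * e i (t - int j) \<omega>)"
proof -
  have "AE \<omega> in M. \<forall>t. X i t \<omega> = A i \<omega> * X i (t - 1) \<omega> + e i t \<omega>"
    unfolding AE_all_countable using series_recursion by blast
  then show ?thesis
  proof eventually_elim
    case (elim \<omega>)
    show ?case
    proof (intro allI)
      fix t n show "X i t \<omega> = A i \<omega> ^ n * X i (t - int n) \<omega> + (\<Sum>j<n. A i \<omega> ^ j * e i (t - int j) \<omega>)"
      proof (induction n)
        case (Suc n)
        have "X i (t - int n) \<omega> = A i \<omega> * X i (t - int (Suc n)) \<omega> + e i (t - int n) \<omega>"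
          using elim[rule_format, of "t - int n"] by (simp add: algebra_simps)
        with Suc show ?case by (simp add: algebra_simps)
      qed simp
    qed
  qed
qed

text \<open>
  A stationary solution of the recursion has no choice but to be the causal moving average. The
  difference of the two is the limit of \<open>A i ^ n * X i (t - n)\<close>, which vanishes because the law of
  \<open>X i (t - n)\<close> does not depend on \<open>n\<close>. This is what makes the series of the panel independent and
  identically distributed: each is a function of its own coefficient and errors.
\<close>

lemma series_moving_average:
  "AE \<omega> in M. \<forall>t. (\<lambda>j. A i \<omega> ^ j * e i (t - int j) \<omega>) sums X i t \<omega>"
  unfolding AE_all_countable
proof
  fix t :: int
  define Z where "Z \<omega> = (\<Sum>j. A i \<omega> ^ j * e i (t - int j) \<omega>)" for \<omega>
  have [measurable]: "random_variable borel Z" unfolding Z_def by measurable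
  have Z: "AE \<omega> in M. (\<lambda>j. A i \<omega> ^ j * e i (t - int j) \<omega>) sums Z \<omega>"
    using geometric_error_series_summable[of i] coeff_range[of i]
  proof eventually_elim
    case (elim \<omega>)
    then have "summable (\<lambda>j. \<bar>A i \<omega> ^ j * e i (t - int j) \<omega>\<bar>)"
      by (auto simp: abs_mult)
    then show ?case unfolding Z_def by (rule summable_sums[OF summable_rabs_cancel])
  qed
  have "AE \<omega> in M. X i t \<omega> - Z \<omega> = 0"
  proof (rule tight_times_vanishing_limit_zero[of M "\<lambda>n \<omega>. A i \<omega> ^ n" "\<lambda>n. X i (t - int n)"])
    show "distr M borel (X i (t - int n)) = distr M borel (X i (t - int 0))" for n
      by (rule strictly_stationary_marginal[OF series_stationary series_measurable])
    show "AE \<omega> in M. (\<lambda>n. A i \<omega> ^ n) \<longlonglongrightarrow> 0"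
      using coeff_range[of i] by eventually_elim (auto intro: LIMSEQ_power_zero)
    show "AE \<omega> in M. (\<lambda>n. A i \<omega> ^ n * X i (t - int n) \<omega>) \<longlonglongrightarrow> X i t \<omega> - Z \<omega>"
      using series_unrolled[of i] Z
    proof eventually_elim
      case (elim \<omega>)
      have "A i \<omega> ^ n * X i (t - int n) \<omega> = X i t \<omega> - (\<Sum>j<n. A i \<omega> ^ j * e i (t - int j) \<omega>)" for n
        using elim(1)[rule_format, of t n] by simp
      then show ?case using tendsto_diff[OF tendsto_const elim(2)[unfolded sums_def]] by simp
    qed
  qed (auto simp: prob_space_axioms)
  with Z show "AE \<omega> in M. (\<lambda>j. A i \<omega> ^ j * e i (t - int j) \<omega>) sums X i t \<omega>"
    by eventually_elim simp
qed

text \<open>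
  In terms of \<open>u = (A i)\<^sup>2\<close> the integrand is \<open>u powr (k / 2) / (1 - u)\<close>, which shifts the parameters of the
  Beta integral from \<open>(a, b)\<close> to \<open>(a + k / 2, b - 1)\<close>. This is where the Beta quotients of the
  autocovariances come from.
\<close>

lemma coeff_moment:
  assumes a: "a > 0" and b: "b > 1"
  shows "has_bochner_integral M (\<lambda>\<omega>. A i \<omega> ^ k / (1 - (A i \<omega>)\<^sup>2)) (Beta (a + real k / 2) (b - 1) / Beta a b)"
proof -
  define g where "g u = u powr (real k / 2) / (1 - u)" for u :: real
  have [measurable]: "g \<in> borel_measurable borel" "beta_density a b \<in> borel_measurable borel"
    unfolding g_def beta_density_def by measurable
  have dens: "0 \<le> beta_density a b u" for u
    using beta_real_pos[of a b] a b by (simp add: beta_density_def)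
  have nonneg: "0 \<le> beta_density a b u * g u" for u
    using beta_real_pos[of a b] a b by (simp add: beta_density_def g_def)
  have "((\<lambda>u. u powr (a + real k / 2 - 1) * (1 - u) powr (b - 1 - 1) / Beta a b) has_integral
      (Beta (a + real k / 2) (b - 1) / Beta a b)) {0<..<1}"
    using has_integral_Beta_real[of "a + real k / 2" "b - 1"] a b
    by (intro has_integral_divide) (simp add: has_integral_Icc_iff_Ioo)
  moreover have "u powr (a + real k / 2 - 1) * (1 - u) powr (b - 1 - 1) / Beta a b = beta_density a b u * g u"
    if "u \<in> {0<..<1}" for u
  proof -
    have "u powr (a + real k / 2 - 1) = u powr (a - 1) * u powr (real k / 2)"
      by (simp add: powr_add[symmetric] algebra_simps)
    moreover have "(1 - u) powr (b - 1 - 1) = (1 - u) powr (b - 1) / (1 - u)"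
      using that by (subst powr_diff) auto
    ultimately show ?thesis using that by (simp add: beta_density_def g_def mult_ac)
  qed
  ultimately have "((\<lambda>u. beta_density a b u * g u) has_integral
      (Beta (a + real k / 2) (b - 1) / Beta a b)) {0<..<1}"
    by (rule has_integral_eq[rotated]) 
  then have "((\<lambda>u. beta_density a b u * g u) has_integral (Beta (a + real k / 2) (b - 1) / Beta a b)) UNIV"
    by (rule has_integral_on_superset) (auto simp: beta_density_def)
  then have nn: "(\<integral>\<^sup>+u. ennreal (beta_density a b u * g u) \<partial>lborel) = ennreal (Beta (a + real k / 2) (b - 1) / Beta a b)"
    using nonneg by (intro nn_integral_has_integral_lborel) auto
  have "has_bochner_integral lborel (\<lambda>u. beta_density a b u * g u) (Beta (a + real k / 2) (b - 1) / Beta a b)"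
    using nn nonneg a b beta_real_pos[of a b] beta_real_pos[of "a + real k / 2" "b - 1"]
    by (intro has_bochner_integral_nn_integral) auto
  then have "has_bochner_integral M (\<lambda>\<omega>. g ((A i \<omega>)\<^sup>2)) (Beta (a + real k / 2) (b - 1) / Beta a b)"
    using distributed_integrable[OF coeff_square_beta[of i], of g] distributed_integral[OF coeff_square_beta[of i], of g] dens
    by (simp add: has_bochner_integral_iff)
  moreover have "AE \<omega> in M. A i \<omega> ^ k / (1 - (A i \<omega>)\<^sup>2) = g ((A i \<omega>)\<^sup>2)"
    using coeff_range[of i]
  proof eventually_elim
    case (elim \<omega>)
    then have "(A i \<omega>)\<^sup>2 powr (real k / 2) = A i \<omega> powr (2 * (real k / 2))"
      by (simp only: powr_powr[symmetric] powr_numeral[OF less_imp_le])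
    with elim show ?case by (simp add: g_def powr_realpow)
  qed
  ultimately show ?thesis
    by (subst has_bochner_integral_cong_AE) auto
qed

text \<open>
  Given the coefficient, the errors are white noise. The products factorise by independence of
  the coefficient and one or two errors; the two cases \<open>t = s\<close> and \<open>t \<noteq> s\<close> differ in the number of independent
  factors, hence the power \<open>m\<close> in \<open>F\<close>.
\<close>

lemma weighted_error_moments:
  assumes [measurable]: "\<phi> \<in> borel_measurable borel"
    and bound: "\<And>\<alpha>. 0 < \<alpha> \<Longrightarrow> \<alpha> < 1 \<Longrightarrow> \<bar>\<phi> \<alpha>\<bar> \<le> B"
  shows "expectation (\<lambda>\<omega>. \<phi> (A i \<omega>) * e i t \<omega>) = 0"
    and "integrable M (\<lambda>\<omega>. \<phi> (A i \<omega>) * (e i t \<omega> * e i s \<omega>))"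
    and "expectation (\<lambda>\<omega>. \<phi> (A i \<omega>) * (e i t \<omega> * e i s \<omega>)) =
      (if t = s then expectation (\<lambda>\<omega>. \<phi> (A i \<omega>)) * \<sigma>\<^sup>2 else 0)"
proof -
  have \<phi>_int: "integrable M (\<lambda>\<omega>. \<phi> (A i \<omega>))" for i
  proof (rule integrable_const_bound[where B = B])
    show "AE \<omega> in M. norm (\<phi> (A i \<omega>)) \<le> B"
      using coeff_range[of i] by eventually_elim (simp add: bound)
  qed simp
  define F where "F m k = (case k of Inl _ \<Rightarrow> \<phi> | Inr _ \<Rightarrow> (\<lambda>x::real. x ^ m))" for m :: nat and k :: "nat + nat \<times> int"
  define Y where "Y m k \<omega> = F m k (case_sum A (\<lambda>(i, t). e i t) k \<omega>)" for m k \<omega>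
  have indep: "indep_vars (\<lambda>_. borel) (Y m) I" for m I
    unfolding Y_def
    by (rule indep_vars_compose2[OF indep_vars_subset[OF independent]]) (auto simp: F_def split: sum.split)
  have Y [simp]: "Y m (Inl j) = (\<lambda>\<omega>. \<phi> (A j \<omega>))" "Y m (Inr (j, r)) = (\<lambda>\<omega>. e j r \<omega> ^ m)" for m j r
    by (auto simp: Y_def F_def)
  have Y_int: "integrable M (Y 1 k)" "integrable M (Y 2 k)" for k
    using \<phi>_int error_integrable error_square_integrable by (cases k; auto)+
  note prod_int = indep_vars_integrable[OF _ indep Y_int(1)] indep_vars_integrable[OF _ indep Y_int(2)]
    and prod_eq = indep_vars_lebesgue_integral[OF _ indep Y_int(1)] indep_vars_lebesgue_integral[OF _ indep Y_int(2)]
  show "expectation (\<lambda>\<omega>. \<phi> (A i \<omega>) * e i t \<omega>) = 0"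
    using prod_eq(1)[of "{Inl i, Inr (i, t)}"] error_mean by simp
  show "integrable M (\<lambda>\<omega>. \<phi> (A i \<omega>) * (e i t \<omega> * e i s \<omega>))"
    using prod_int(2)[of "{Inl i, Inr (i, t)}"] prod_int(1)[of "{Inl i, Inr (i, t), Inr (i, s)}"]
    by (cases "t = s") (auto simp: power2_eq_square)
  show "expectation (\<lambda>\<omega>. \<phi> (A i \<omega>) * (e i t \<omega> * e i s \<omega>)) =
      (if t = s then expectation (\<lambda>\<omega>. \<phi> (A i \<omega>)) * \<sigma>\<^sup>2 else 0)"
  proof (cases "t = s")
    case True
    then show ?thesis
      using prod_eq(2)[of "{Inl i, Inr (i, t)}"] error_second_moment by (simp add: power2_eq_square)
  next
    case False
    then show ?thesis
      using prod_eq(1)[of "{Inl i, Inr (i, t), Inr (i, s)}"] error_mean by simp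
  qed
qed

end

section \<open>Second moments of filtered panel series\<close>

text \<open>
  With \<open>\<rho>\<close> an autocovariance function, this is the variance of \<open>c 0 x\<^sub>t + \<dots> + c p x\<^bsub>t-p\<^esub>\<close>.
\<close>

definition toeplitz_form :: "(nat \<Rightarrow> real) \<Rightarrow> nat \<Rightarrow> (nat \<Rightarrow> real) \<Rightarrow> real" where
  "toeplitz_form \<rho> p c = (\<Sum>s\<le>p. \<Sum>s'\<le>p. c s * c s' * \<rho> (nat \<bar>int s - int s'\<bar>))"

lemma response_weight_measurable [measurable]: "(\<lambda>\<alpha>. response_weight c p \<alpha> j) \<in> borel_measurable borel"
  unfolding response_weight_def by measurable

lemma response_weight_bound:
  assumes "0 < \<alpha>" "\<alpha> < 1"
  shows "\<bar>response_weight c p \<alpha> j\<bar> \<le> (\<Sum>s\<le>p. \<bar>c s\<bar>)"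
  unfolding response_weight_def
proof (rule order_trans[OF sum_abs sum_mono])
  fix s
  have "\<bar>c s\<bar> * \<alpha> ^ (j - s) \<le> \<bar>c s\<bar> * 1"
    using assms by (intro mult_left_mono power_le_one) auto
  then show "\<bar>if s \<le> j then c s * \<alpha> ^ (j - s) else 0\<bar> \<le> \<bar>c s\<bar>"
    using assms by (simp add: abs_mult)
qed

lemma response_weight_mult_bound:
  assumes "0 < \<alpha>" "\<alpha> < 1"
  shows "\<bar>response_weight c p \<alpha> j * response_weight c p \<alpha> k\<bar> \<le> (\<Sum>s\<le>p. \<bar>c s\<bar>)\<^sup>2"
  unfolding abs_mult power2_eq_square
  using assms by (intro mult_mono response_weight_bound) (auto intro!: sum_nonneg)

context ar1_panel
begin

text \<open>
  Taking expectations in the sum of squares of the impulse response term by term. The limit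
  \<open>Q\<close> is a finite combination of the variables of \<open>coeff_moment\<close>; its integrability bounds the partial
  sums and so justifies the interchange.
\<close>

lemma response_weight_moments:
  assumes ab: "a > 0" "b > 1"
  shows "(\<lambda>j. expectation (\<lambda>\<omega>. (response_weight c p (A i \<omega>) j)\<^sup>2)) sums
      (Beta a (b - 1) / Beta a b * toeplitz_form (\<gamma>_CSA a b) p c)"
proof -
  define W where "W j \<omega> = (response_weight c p (A i \<omega>) j)\<^sup>2" for j \<omega>
  define Q where "Q \<omega> = (\<Sum>s\<le>p. \<Sum>s'\<le>p. c s * c s' *
    (A i \<omega> ^ nat \<bar>int s - int s'\<bar> / (1 - (A i \<omega>)\<^sup>2)))" for \<omega>
  have [measurable]: "random_variable borel (W j)" for j unfolding W_def by measurable
  have Q: "has_bochner_integral M Q (\<Sum>s\<le>p. \<Sum>s'\<le>p. c s * c s' *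
      (Beta (a + real (nat \<bar>int s - int s'\<bar>) / 2) (b - 1) / Beta a b))"
    unfolding Q_def[abs_def]
    by (intro has_bochner_integral_sum has_bochner_integral_mult_right coeff_moment ab)
  have "Beta (a + real k / 2) (b - 1) / Beta a b = Beta a (b - 1) / Beta a b * \<gamma>_CSA a b k" for k
    using beta_real_pos[of a "b - 1"] ab by (simp add: \<gamma>_CSA_def)
  then have "expectation Q = (\<Sum>s\<le>p. \<Sum>s'\<le>p. c s * c s' *
      (Beta a (b - 1) / Beta a b * \<gamma>_CSA a b (nat \<bar>int s - int s'\<bar>)))"
    using has_bochner_integral_integral_eq[OF Q] by (simp only:)
  then have Q_value: "expectation Q = Beta a (b - 1) / Beta a b * toeplitz_form (\<gamma>_CSA a b) p c"
    by (simp only: toeplitz_form_def sum_distrib_left mult.left_commute)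
  have W_sums: "AE \<omega> in M. (\<lambda>j. W j \<omega>) sums Q \<omega>"
    using coeff_range[of i]
    by eventually_elim (use response_weight_square_sums in \<open>auto simp: W_def Q_def\<close>)
  have W_int: "integrable M (W j)" for j
  proof (rule integrable_const_bound[where B = "(\<Sum>s\<le>p. \<bar>c s\<bar>)\<^sup>2"])
    show "AE \<omega> in M. norm (W j \<omega>) \<le> (\<Sum>s\<le>p. \<bar>c s\<bar>)\<^sup>2"
      using coeff_range[of i]
      by eventually_elim (use response_weight_mult_bound[of _ c p j j] in \<open>auto simp: W_def power2_eq_square\<close>)
  qed simp
  have nonneg: "0 \<le> W j \<omega>" for j \<omega> by (simp add: W_def)
  have summable: "summable (\<lambda>j. expectation (W j))"
  proof (rule summableI_nonneg_bounded)
    show "0 \<le> expectation (W j)" for j using nonneg by (intro Bochner_Integration.integral_nonneg)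
    show "(\<Sum>j<n. expectation (W j)) \<le> expectation Q" for n
    proof -
      have "(\<Sum>j<n. expectation (W j)) = expectation (\<lambda>\<omega>. \<Sum>j<n. W j \<omega>)"
        using W_int by (simp add: Bochner_Integration.integral_sum)
      also have "\<dots> \<le> expectation Q"
      proof (rule integral_mono_AE)
        show "AE \<omega> in M. (\<Sum>j<n. W j \<omega>) \<le> Q \<omega>"
          using W_sums
        proof eventually_elim
          case (elim \<omega>)
          then show ?case using sum_le_suminf[OF sums_summable[OF elim], of "{..<n}"] nonneg
            by (simp add: sums_unique[OF elim])
        qed
      qed (use W_int Q in \<open>auto simp: has_bochner_integral_iff\<close>)
      finally show ?thesis .
    qed
  qed
  have "(\<lambda>j. expectation (W j)) sums expectation (\<lambda>\<omega>. \<Sum>j. W j \<omega>)"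
    using W_sums nonneg summable
    by (intro sums_integral W_int) (auto elim!: eventually_mono intro: sums_summable)
  also have "expectation (\<lambda>\<omega>. \<Sum>j. W j \<omega>) = expectation Q"
    using W_sums Q by (intro integral_cong_AE) (auto elim!: eventually_mono simp: sums_iff has_bochner_integral_iff)
  finally show "(\<lambda>j. expectation (\<lambda>\<omega>. (response_weight c p (A i \<omega>) j)\<^sup>2)) sums
      (Beta a (b - 1) / Beta a b * toeplitz_form (\<gamma>_CSA a b) p c)"
    unfolding W_def Q_value .
qed

text \<open>
  A positive multiple of the form is a sum of expected squares, and the weight at the first nonzero coefficient of \<open>c\<close> is
  that coefficient itself. The coefficient \<open>A 0\<close> of the panel serves as a variable with the mixing law.
\<close>

lemma toeplitz_form_\<gamma>_CSA_pos:
  assumes ab: "a > 0" "b > 1" and c: "s \<le> p" "c s \<noteq> 0"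
  shows "0 < toeplitz_form (\<gamma>_CSA a b) p c"
proof -
  define m where "m = (LEAST s. c s \<noteq> 0)"
  have m: "c m \<noteq> 0" unfolding m_def by (rule LeastI[of _ s], rule c(2))
  have "m \<le> s" unfolding m_def by (rule Least_le, rule c(2))
  then have mp: "m \<le> p" using c(1) by simp
  have below: "c r = 0" if "r < m" for r
    using not_less_Least[OF that[unfolded m_def]] by simp
  note sums = response_weight_moments[OF ab, of c p 0]
  have "0 < expectation (\<lambda>\<omega>. (response_weight c p (A 0 \<omega>) m)\<^sup>2)"
    using m by (simp add: response_weight_first[OF below mp] prob_space)
  also have "\<dots> \<le> Beta a (b - 1) / Beta a b * toeplitz_form (\<gamma>_CSA a b) p c"
    unfolding sums_unique[OF sums] using sum_le_suminf[OF sums_summable[OF sums], of "{m}"] by simp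
  finally show ?thesis
    using beta_real_pos[of a b] beta_real_pos[of a "b - 1"] ab
    by (elim zero_less_mult_pos) simp
qed

text \<open>
  A version of the filtered series \<open>\<Sum>s\<le>p. c s * X i (t - s)\<close> that is, without exceptional null set, a
  function of the coefficient and the errors of the \<open>i\<close>-th series. Independence over \<open>i\<close> and equality of laws can
  therefore be read off from the primitives of the panel.
\<close>

definition filtered :: "(nat \<Rightarrow> real) \<Rightarrow> nat \<Rightarrow> int \<Rightarrow> nat \<Rightarrow> 'w \<Rightarrow> real" where
  "filtered c p t i \<omega> = (\<Sum>j. response_weight c p (A i \<omega>) j * e i (t - int j) \<omega>)"

lemma filtered_measurable [measurable]: "random_variable borel (filtered c p t i)"
  unfolding filtered_def by measurable

lemma filtered_sums:
  "AE \<omega> in M. (\<lambda>j. response_weight c p (A i \<omega>) j * e i (t - int j) \<omega>) sums filtered c p t i \<omega>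
    \<and> filtered c p t i \<omega> = (\<Sum>s\<le>p. c s * X i (t - int s) \<omega>)"
  using series_moving_average[of i]
proof eventually_elim
  case (elim \<omega>)
  have "(\<lambda>j. response_weight c p (A i \<omega>) j * e i (t - int j) \<omega>) sums (\<Sum>s\<le>p. c s * X i (t - int s) \<omega>)"
    by (rule combination_of_filters_sums) (use elim in blast)
  then show ?case unfolding filtered_def by (auto simp: sums_iff)
qed

lemma filtered_moments:
  assumes ab: "a > 0" "b > 1"
  shows "integrable M (\<lambda>\<omega>. (filtered c p t i \<omega>)\<^sup>2)"
    and "expectation (filtered c p t i) = 0"
    and "expectation (\<lambda>\<omega>. (filtered c p t i \<omega>)\<^sup>2) =
      \<sigma>\<^sup>2 * (Beta a (b - 1) / Beta a b) * toeplitz_form (\<gamma>_CSA a b) p c"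
proof -
  define f where "f j \<omega> = response_weight c p (A i \<omega>) j * e i (t - int j) \<omega>" for j \<omega>
  have f_mult: "(\<lambda>\<omega>. f j \<omega> * f k \<omega>) = (\<lambda>\<omega>. (response_weight c p (A i \<omega>) j * response_weight c p (A i \<omega>) k) *
      (e i (t - int j) \<omega> * e i (t - int k) \<omega>))" for j k
    by (auto simp: f_def mult_ac)
  have int: "integrable M (\<lambda>\<omega>. f j \<omega> * f k \<omega>)"
    and product: "expectation (\<lambda>\<omega>. f j \<omega> * f k \<omega>) =
      (if j = k then expectation (\<lambda>\<omega>. (response_weight c p (A i \<omega>) j)\<^sup>2) * \<sigma>\<^sup>2 else 0)" for j k
    unfolding f_mult
    using weighted_error_moments(2,3)[of "\<lambda>\<alpha>. response_weight c p \<alpha> j * response_weight c p \<alpha> k",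
      OF _ response_weight_mult_bound, of i "t - int j" "t - int k"]
    by (auto simp: power2_eq_square)
  have second: "(\<lambda>j. expectation (\<lambda>\<omega>. (f j \<omega>)\<^sup>2)) sums
      (\<sigma>\<^sup>2 * (Beta a (b - 1) / Beta a b) * toeplitz_form (\<gamma>_CSA a b) p c)"
  proof -
    have "expectation (\<lambda>\<omega>. (f j \<omega>)\<^sup>2) = \<sigma>\<^sup>2 * expectation (\<lambda>\<omega>. (response_weight c p (A i \<omega>) j)\<^sup>2)" for j
      using product[of j j] by (simp add: power2_eq_square)
    then show ?thesis
      using sums_mult[OF response_weight_moments[OF ab, of c p i], of "\<sigma>\<^sup>2"] by (simp add: mult_ac)
  qed
  have rv: "random_variable borel (f j)" for j unfolding f_def by measurable
  have mean: "expectation (f j) = 0" for j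
    unfolding f_def by (rule weighted_error_moments(1)[OF _ response_weight_bound]) simp
  have orth: "expectation (\<lambda>\<omega>. f j \<omega> * f k \<omega>) = 0" if "j \<noteq> k" for j k
    using product that by simp
  have conv: "AE \<omega> in M. (\<lambda>j. f j \<omega>) sums filtered c p t i \<omega>"
    using filtered_sums[of c p i t] unfolding f_def by eventually_elim blast
  note parseval = orthogonal_series_second_moment[of f, OF rv filtered_measurable int mean orth conv second]
  show "integrable M (\<lambda>\<omega>. (filtered c p t i \<omega>)\<^sup>2)" "expectation (filtered c p t i) = 0"
    "expectation (\<lambda>\<omega>. (filtered c p t i \<omega>)\<^sup>2) =
      \<sigma>\<^sup>2 * (Beta a (b - 1) / Beta a b) * toeplitz_form (\<gamma>_CSA a b) p c"
    using parseval by blast+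
qed

section \<open>The central limit theorem for the aggregates\<close>

text \<open>
  The primitives of different series form disjoint blocks \<open>K i\<close> of one independent family.
\<close>

lemma filtered_independent: "indep_vars (\<lambda>_. borel) (filtered c p t) UNIV"
proof -
  define K :: "nat \<Rightarrow> (nat + nat \<times> int) set" where "K i = insert (Inl i) (Inr ` ({i} \<times> UNIV))" for i
  define H where "H i V = (\<Sum>j. response_weight c p (V (Inl i)) j * V (Inr (i, t - int j)))"
    for i and V :: "nat + nat \<times> int \<Rightarrow> real"
  have "indep_vars (\<lambda>i. Pi\<^sub>M (K i) (\<lambda>_. borel))
      (\<lambda>i \<omega>. restrict (\<lambda>k. case_sum A (\<lambda>(i, t). e i t) k \<omega>) (K i)) UNIV"
    by (rule indep_vars_restrict[OF independent]) (auto simp: K_def disjoint_family_on_def)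
  moreover have "H i \<in> borel_measurable (Pi\<^sub>M (K i) (\<lambda>_. borel))" for i
  proof -
    have [measurable]: "(\<lambda>V. V (Inl i)) \<in> borel_measurable (Pi\<^sub>M (K i) (\<lambda>_. borel :: real measure))"
      "(\<lambda>V. V (Inr (i, r))) \<in> borel_measurable (Pi\<^sub>M (K i) (\<lambda>_. borel :: real measure))" for r
      by (auto simp: K_def intro!: measurable_component_singleton)
    show ?thesis unfolding H_def by measurable
  qed
  ultimately have "indep_vars (\<lambda>_. borel)
      (\<lambda>i \<omega>. H i (restrict (\<lambda>k. case_sum A (\<lambda>(i, t). e i t) k \<omega>) (K i))) UNIV"
    by (rule indep_vars_compose2)
  moreover have "H i (restrict (\<lambda>k. case_sum A (\<lambda>(i, t). e i t) k \<omega>) (K i)) = filtered c p t i \<omega>" for i \<omega>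
    by (simp add: H_def filtered_def K_def)
  ultimately show ?thesis by simp
qed

lemma coeff_identically_distributed: "distr M borel (A i) = distr M borel (A j)"
proof -
  have "distr M borel (A i) = distr (density lborel (\<lambda>u. ennreal (beta_density a b u))) borel sqrt" for i
  proof -
    have "distr M borel (A i) = distr M borel (\<lambda>\<omega>. sqrt ((A i \<omega>)\<^sup>2))"
      using coeff_range[of i] by (intro distr_cong_AE) (auto elim!: eventually_mono)
    also have "\<dots> = distr (distr M lborel (\<lambda>\<omega>. (A i \<omega>)\<^sup>2)) borel sqrt"
      by (subst distr_distr) (auto simp: comp_def)
    finally show ?thesis using distributed_distr_eq_density[OF coeff_square_beta[of i]] by simp
  qed
  then show ?thesis by metis
qed

text \<open>
  The primitives of the \<open>i\<close>-th series, indexed by \<open>int option\<close> with \<open>None\<close> for the coefficient, have a law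
  that is the product of their marginals and thus the same for every \<open>i\<close>; the filtered series is one
  and the same functional \<open>H\<close> of them.
\<close>

lemma filtered_identically_distributed:
  "distr M borel (filtered c p t i) = distr M borel (filtered c p t 0)"
proof -
  define fam where "fam = case_sum A (\<lambda>(i, t). e i t)"
  define h :: "nat \<Rightarrow> int option \<Rightarrow> nat + nat \<times> int"
    where "h i k = (case k of None \<Rightarrow> Inl i | Some r \<Rightarrow> Inr (i, r))" for i k
  define H where "H V = (\<Sum>j. response_weight c p (V None) j * V (Some (t - int j)))"
    for V :: "int option \<Rightarrow> real"
  have fam_rv [measurable]: "random_variable borel (fam k)" for k
    by (auto simp: fam_def split: sum.split)
  have fam_h: "fam (h i None) = A i" "fam (h i (Some r)) = e i r" for i r
    by (auto simp: fam_def h_def)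
  have H_meas [measurable]: "H \<in> borel_measurable (Pi\<^sub>M UNIV (\<lambda>_. borel))"
    unfolding H_def by measurable
  have joint: "distr M (Pi\<^sub>M UNIV (\<lambda>_. borel)) (\<lambda>\<omega> k. fam k \<omega>) = Pi\<^sub>M UNIV (\<lambda>k. distr M borel (fam k))"
    using indep_vars_iff_distr_eq_PiM[where I = UNIV and M' = "\<lambda>_. borel" and X = fam] independent
    by (simp add: fam_def[symmetric] restrict_def)
  have law: "distr M (Pi\<^sub>M UNIV (\<lambda>_. borel)) (\<lambda>\<omega> k. fam (h i k) \<omega>) = Pi\<^sub>M UNIV (\<lambda>k. distr M borel (fam (h i k)))" for i
  proof -
    have "Pi\<^sub>M UNIV (\<lambda>k. distr M borel (fam (h i k))) =
        distr (Pi\<^sub>M UNIV (\<lambda>k. distr M borel (fam k))) (Pi\<^sub>M UNIV (\<lambda>k. distr M borel (fam (h i k)))) (\<lambda>V. \<lambda>k\<in>UNIV. V (h i k))"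
      by (rule distr_PiM_reindex[symmetric]) (auto intro!: prob_space_distr simp: inj_on_def h_def split: option.splits)
    also have "\<dots> = distr (Pi\<^sub>M UNIV (\<lambda>k. distr M borel (fam k))) (Pi\<^sub>M UNIV (\<lambda>_. borel)) (\<lambda>V k. V (h i k))"
      by (intro distr_cong sets_PiM_cong) auto
    also have "\<dots> = distr M (Pi\<^sub>M UNIV (\<lambda>_. borel)) (\<lambda>\<omega> k. fam (h i k) \<omega>)"
      unfolding joint[symmetric]
      by (subst distr_distr) (auto simp: comp_def intro!: measurable_PiM_single')
    finally show ?thesis ..
  qed
  have "distr M borel (fam (h i k)) = distr M borel (fam (h 0 k))" for i k
    by (cases k) (auto simp: fam_h intro: coeff_identically_distributed error_identically_distributed)
  then have "(\<lambda>k. distr M borel (fam (h i k))) = (\<lambda>k. distr M borel (fam (h 0 k)))" for i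
    by (rule ext)
  then have law_eq: "distr M (Pi\<^sub>M UNIV (\<lambda>_. borel)) (\<lambda>\<omega> k. fam (h i k) \<omega>) =
      distr M (Pi\<^sub>M UNIV (\<lambda>_. borel)) (\<lambda>\<omega> k. fam (h 0 k) \<omega>)" for i
    unfolding law by (rule arg_cong)
  have "distr M borel (filtered c p t i) = distr (distr M (Pi\<^sub>M UNIV (\<lambda>_. borel)) (\<lambda>\<omega> k. fam (h i k) \<omega>)) borel H" for i
    by (subst distr_distr)
      (auto simp: comp_def H_def filtered_def[abs_def] fam_h intro!: measurable_PiM_single')
  then show ?thesis using law_eq[of i] by simp
qed

text \<open>
  A nonzero coefficient makes the common variance positive, so that the sums can be normalised
  to the standard normal law.
\<close>

lemma filtered_central_limit:
  assumes ab: "a > 0" "b > 1" and c: "s \<le> p" "c s \<noteq> 0"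
    and v: "v = \<sigma>\<^sup>2 * (Beta a (b - 1) / Beta a b) * toeplitz_form (\<gamma>_CSA a b) p c"
  shows "0 < v"
    and "weak_conv_m (\<lambda>n. distr M borel (\<lambda>\<omega>. (\<Sum>i<n. filtered c p t i \<omega>) / sqrt (real n * v)))
      std_normal_distribution"
proof -
  show "0 < v"
    using sigma_pos beta_real_pos[of a b] beta_real_pos[of a "b - 1"] ab
      toeplitz_form_\<gamma>_CSA_pos[where s = s and c = c, OF ab c] by (simp add: v)
  then have sq: "(sqrt v)\<^sup>2 = v" by simp
  have "weak_conv_m (\<lambda>n. distr M borel (\<lambda>\<omega>. (\<Sum>i<n. filtered c p t i \<omega>) / sqrt (real n * (sqrt v)\<^sup>2)))
      std_normal_distribution"
  proof (rule central_limit_theorem_zero_mean)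
    show "variance (filtered c p t n) = (sqrt v)\<^sup>2" for n
      unfolding sq using filtered_moments(2,3)[OF ab] by (simp add: v)
  qed (use filtered_independent filtered_moments[OF ab] filtered_identically_distributed \<open>0 < v\<close> in auto)
  then show "weak_conv_m (\<lambda>n. distr M borel (\<lambda>\<omega>. (\<Sum>i<n. filtered c p t i \<omega>) / sqrt (real n * v)))
      std_normal_distribution" unfolding sq .
qed

lemma aggregate_combination:
  "AE \<omega> in M. (\<Sum>s\<le>p. c s * aggregate X n (t - int s) \<omega>) = (\<Sum>i<n. filtered c p t i \<omega>) / sqrt (real n)"
proof -
  have "AE \<omega> in M. \<forall>i. filtered c p t i \<omega> = (\<Sum>s\<le>p. c s * X i (t - int s) \<omega>)"
    unfolding AE_all_countable using filtered_sums by (auto elim: eventually_mono)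
  then show ?thesis
  proof eventually_elim
    case (elim \<omega>)
    have "(\<Sum>s\<le>p. c s * aggregate X n (t - int s) \<omega>) = (\<Sum>s\<le>p. \<Sum>i<n. c s * X i (t - int s) \<omega> / sqrt (real n))"
      by (simp add: aggregate_def sum_distrib_left sum_divide_distrib)
    also have "\<dots> = (\<Sum>i<n. (\<Sum>s\<le>p. c s * X i (t - int s) \<omega>) / sqrt (real n))"
      by (subst sum.swap) (simp add: sum_divide_distrib)
    finally show ?case using elim by (simp add: sum_divide_distrib)
  qed
qed

end

section \<open>The law of linear combinations of the limit process\<close>

text \<open>
  Uniqueness of characteristic functions in real form: convergence in law is expressed by
  real test functions.
\<close>

lemma real_distribution_eqI_cos_sin:
  fixes \<mu> \<nu> :: "real measure"
  assumes "real_distribution \<mu>" "real_distribution \<nu>"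
    and cos: "\<And>\<tau>. (\<integral>y. cos (\<tau> * y) \<partial>\<mu>) = (\<integral>y. cos (\<tau> * y) \<partial>\<nu>)"
    and sin: "\<And>\<tau>. (\<integral>y. sin (\<tau> * y) \<partial>\<mu>) = (\<integral>y. sin (\<tau> * y) \<partial>\<nu>)"
  shows "\<mu> = \<nu>"
proof (rule Levy_uniqueness[OF assms(1,2)], rule ext)
  have parts: "Re (char \<kappa> \<tau>) = (\<integral>y. cos (\<tau> * y) \<partial>\<kappa>)" "Im (char \<kappa> \<tau>) = (\<integral>y. sin (\<tau> * y) \<partial>\<kappa>)"
    if "real_distribution \<kappa>" for \<kappa> \<tau>
  proof -
    interpret real_distribution \<kappa> by fact
    have "integrable \<kappa> (\<lambda>y. iexp (\<tau> * y))"
      by (intro integrable_iexp) auto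
    from integral_Re[OF this] integral_Im[OF this]
    show "Re (char \<kappa> \<tau>) = (\<integral>y. cos (\<tau> * y) \<partial>\<kappa>)" "Im (char \<kappa> \<tau>) = (\<integral>y. sin (\<tau> * y) \<partial>\<kappa>)"
      by (simp_all add: char_def Re_exp Im_exp)
  qed
  show "char \<mu> \<tau> = char \<nu> \<tau>" for \<tau>
    by (rule complex_eqI) (simp_all add: parts[OF assms(1)] parts[OF assms(2)] cos sin)
qed

text \<open>
  A linear combination of finitely many values of the process is a continuous function of the
  path, so the combinations of the aggregates converge in law to that of the limit process. By the
  central limit theorem they converge to a normal law as well, and the two limits agree.
\<close>

lemma CSA_combination_normal:
  fixes x :: "int \<Rightarrow> 'v \<Rightarrow> real"
  assumes ab: "a > 0" "b > 1" and csa: "CSA_process a b \<sigma> P A e X M x" and c: "s \<le> p" "c s \<noteq> 0"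
    and v: "v = \<sigma>\<^sup>2 * (Beta a (b - 1) / Beta a b) * toeplitz_form (\<gamma>_CSA a b) p c"
  shows "0 < v"
    and "distr M borel (\<lambda>\<omega>. (\<Sum>s\<le>p. c s * x (t - int s) \<omega>) / sqrt v) = std_normal_distribution"
proof -
  interpret P: ar1_panel P a b \<sigma> A e X using csa by (simp add: CSA_process_def)
  interpret M: prob_space M using csa by (simp add: CSA_process_def)
  have [measurable]: "x t \<in> borel_measurable M" for t using csa by (simp add: CSA_process_def)
  show v_pos: "0 < v" by (rule P.filtered_central_limit(1)[where s = s and c = c, OF ab c v])
  define \<Phi> where "\<Phi> y = (\<Sum>s\<le>p. c s * y (t - int s)) / sqrt v" for y :: "int \<Rightarrow> real"
  define S where "S n \<omega> = (\<Sum>i<n. P.filtered c p t i \<omega>) / sqrt (real n * v)" for n \<omega>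
  have [measurable]: "S n \<in> borel_measurable P" for n unfolding S_def by measurable
  have [measurable]: "(\<lambda>\<omega>. \<Phi> (\<lambda>t. x t \<omega>)) \<in> borel_measurable M" unfolding \<Phi>_def by measurable
  have [measurable]: "(\<lambda>\<omega>. \<Phi> (\<lambda>t. aggregate X n t \<omega>)) \<in> borel_measurable P" for n
    unfolding \<Phi>_def aggregate_def by measurable
  have \<Phi>_cont: "continuous_on UNIV \<Phi>"
    unfolding \<Phi>_def using v_pos by (intro continuous_intros continuous_on_product_coordinates) auto
  have same: "(\<integral>y. h (\<tau> * y) \<partial>distr M borel (\<lambda>\<omega>. \<Phi> (\<lambda>t. x t \<omega>))) = (\<integral>y. h (\<tau> * y) \<partial>std_normal_distribution)"
    if h: "continuous_on UNIV h" "\<And>y. \<bar>h y\<bar> \<le> 1" for h :: "real \<Rightarrow> real" and \<tau>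
  proof -
    have [measurable]: "h \<in> borel_measurable borel" using h by (intro borel_measurable_continuous_onI)
    have "(\<lambda>n. \<integral>\<omega>. h (\<tau> * \<Phi> (\<lambda>t. aggregate X n t \<omega>)) \<partial>P) \<longlonglongrightarrow> (\<integral>\<omega>. h (\<tau> * \<Phi> (\<lambda>t. x t \<omega>)) \<partial>M)"
    proof -
      have "continuous_on UNIV (\<lambda>y. h (\<tau> * \<Phi> y))"
        by (rule continuous_on_compose2[OF h(1)]) (auto intro!: continuous_intros \<Phi>_cont)
      moreover have "bounded (range (\<lambda>y. h (\<tau> * \<Phi> y)))"
        using h(2) by (auto simp: bounded_iff intro!: exI[of _ 1])
      ultimately show ?thesis using csa by (auto simp: CSA_process_def converges_in_law_def)
    qed
    also have "(\<lambda>n. \<integral>\<omega>. h (\<tau> * \<Phi> (\<lambda>t. aggregate X n t \<omega>)) \<partial>P) = (\<lambda>n. \<integral>y. h (\<tau> * y) \<partial>distr P borel (S n))"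
    proof
      fix n
      have "AE \<omega> in P. \<Phi> (\<lambda>t. aggregate X n t \<omega>) = S n \<omega>"
        using P.aggregate_combination[where c = c and p = p and n = n and t = t]
        by eventually_elim (simp add: \<Phi>_def S_def real_sqrt_mult)
      then have "(\<integral>\<omega>. h (\<tau> * \<Phi> (\<lambda>t. aggregate X n t \<omega>)) \<partial>P) = (\<integral>\<omega>. h (\<tau> * S n \<omega>) \<partial>P)"
        by (intro integral_cong_AE) auto
      then show "(\<integral>\<omega>. h (\<tau> * \<Phi> (\<lambda>t. aggregate X n t \<omega>)) \<partial>P) = (\<integral>y. h (\<tau> * y) \<partial>distr P borel (S n))"
        by (simp add: integral_distr)
    qed
    finally have "(\<lambda>n. \<integral>y. h (\<tau> * y) \<partial>distr P borel (S n)) \<longlonglongrightarrow> (\<integral>\<omega>. h (\<tau> * \<Phi> (\<lambda>t. x t \<omega>)) \<partial>M)" .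
    moreover have "(\<lambda>n. \<integral>y. h (\<tau> * y) \<partial>distr P borel (S n)) \<longlonglongrightarrow> (\<integral>y. h (\<tau> * y) \<partial>std_normal_distribution)"
    proof (rule weak_conv_imp_integral_bdd_continuous_conv)
      show "weak_conv_m (\<lambda>n. distr P borel (S n)) std_normal_distribution"
        unfolding S_def by (rule P.filtered_central_limit(2)[where s = s and c = c, OF ab c v])
      show "isCont (\<lambda>y. h (\<tau> * y)) y" for y
      proof -
        have "continuous_on UNIV (\<lambda>y. h (\<tau> * y))"
          by (rule continuous_on_compose2[OF h(1)]) (auto intro!: continuous_intros)
        then show ?thesis by (simp add: continuous_on_eq_continuous_at)
      qed
    qed (use h(2) in \<open>auto intro!: P.real_distribution_distr real_dist_normal_dist\<close>)
    ultimately show ?thesis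
      by (simp add: LIMSEQ_unique integral_distr)
  qed
  have "distr M borel (\<lambda>\<omega>. \<Phi> (\<lambda>t. x t \<omega>)) = std_normal_distribution"
    by (rule real_distribution_eqI_cos_sin)
      (auto intro!: M.real_distribution_distr real_dist_normal_dist same[of cos] same[of sin] continuous_intros)
  then show "distr M borel (\<lambda>\<omega>. (\<Sum>s\<le>p. c s * x (t - int s) \<omega>) / sqrt v) = std_normal_distribution"
    unfolding \<Phi>_def .
qed

text \<open>
  Convergence in law alone would not transport variances to the limit; the normal law found
  for the combination determines its variance.
\<close>

lemma CSA_combination_variance:
  assumes ab: "a > 0" "b > 1" and csa: "CSA_process a b \<sigma> P A e X M x" and c: "s \<le> p" "c s \<noteq> 0"
  shows "prob_space.variance M (\<lambda>\<omega>. \<Sum>s\<le>p. c s * x (t - int s) \<omega>) =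
    \<sigma>\<^sup>2 * (Beta a (b - 1) / Beta a b) * toeplitz_form (\<gamma>_CSA a b) p c"
proof -
  interpret M: prob_space M using csa by (simp add: CSA_process_def)
  have [measurable]: "x t \<in> borel_measurable M" for t using csa by (simp add: CSA_process_def)
  define v where "v = \<sigma>\<^sup>2 * (Beta a (b - 1) / Beta a b) * toeplitz_form (\<gamma>_CSA a b) p c"
  define Y where "Y \<omega> = (\<Sum>s\<le>p. c s * x (t - int s) \<omega>)" for \<omega>
  have [measurable]: "Y \<in> borel_measurable M" unfolding Y_def by measurable
  note v_pos = CSA_combination_normal(1)[where s = s and c = c, OF ab csa c v_def]
  note normal = CSA_combination_normal(2)[where s = s and c = c and t = t, OF ab csa c v_def, folded Y_def]
  have "(\<integral>\<omega>. Y \<omega> / sqrt v \<partial>M) = (\<integral>y. y \<partial>distr M borel (\<lambda>\<omega>. Y \<omega> / sqrt v))"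
    by (simp add: integral_distr)
  also have "\<dots> = 0"
    unfolding normal using integral_std_normal_distribution_moment_odd[of 1] by simp
  finally have mean: "M.expectation Y = 0" using v_pos by simp
  have "(\<integral>\<omega>. (Y \<omega> / sqrt v)\<^sup>2 \<partial>M) = (\<integral>y. y\<^sup>2 \<partial>distr M borel (\<lambda>\<omega>. Y \<omega> / sqrt v))"
    by (simp add: integral_distr)
  also have "\<dots> = 1"
    unfolding normal using std_normal_distribution_even_moments(1)[of 1] by simp
  finally have "M.expectation (\<lambda>\<omega>. (Y \<omega>)\<^sup>2) = v" using v_pos by (simp add: power_divide)
  then show ?thesis using mean unfolding Y_def v_def by simp
qed

section \<open>Minimising the prediction error form\<close>

text \<open>
  The coefficients of the lag polynomial \<open>1 - \<alpha> 1 L - \<dots> - \<alpha> p L^p\<close>.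
\<close>

abbreviation prediction_error_coeffs :: "(nat \<Rightarrow> real) \<Rightarrow> nat \<Rightarrow> real" where
  "prediction_error_coeffs \<alpha> \<equiv> (\<lambda>i. - \<alpha> i)(0 := 1)"

text \<open>
  The quadratic part, in \<open>\<alpha> 1, \<dots>, \<alpha> p\<close>, of the Toeplitz form at \<open>prediction_error_coeffs \<alpha>\<close>. If
  \<open>\<rho> 0 = 1\<close>, its matrix is the autocorrelation matrix.
\<close>

definition lag_form :: "(nat \<Rightarrow> real) \<Rightarrow> nat \<Rightarrow> (nat \<Rightarrow> real) \<Rightarrow> real" where
  "lag_form \<rho> p d = (\<Sum>i = 1..p. \<Sum>j = 1..p. d i * d j * \<rho> (nat \<bar>int i - int j\<bar>))"

lemma sum_atMost_split_0: "(\<Sum>s\<le>p. f s) = f 0 + (\<Sum>s = 1..p. f s)" for f :: "nat \<Rightarrow> real"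
  by (simp add: sum.atMost_shift sum.atLeast1_atMost_eq)

lemma AR_residual_eq_combination:
  "AR_residual x p \<alpha> t \<omega> = (\<Sum>s\<le>p. prediction_error_coeffs \<alpha> s * x (t - int s) \<omega>)"
  by (simp add: AR_residual_def sum_atMost_split_0 sum_negf)

lemma toeplitz_form_prediction_error:
  assumes "\<rho> 0 = 1"
  shows "toeplitz_form \<rho> p (prediction_error_coeffs \<alpha>) = 1 - 2 * (\<Sum>i = 1..p. \<alpha> i * \<rho> i) + lag_form \<rho> p \<alpha>"
  by (simp add: toeplitz_form_def lag_form_def sum_atMost_split_0 assms sum_negf sum_subtractf sum.distrib)

lemma lag_form_eq_toeplitz_form: "lag_form \<rho> p d = toeplitz_form \<rho> p (d(0 := 0))"
  by (simp add: toeplitz_form_def lag_form_def sum_atMost_split_0)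

text \<open>
  Off the diagonal, each lag \<open>i\<close> collects the pairs \<open>(j, j + i)\<close> and their mirror images. In the step
  from \<open>p\<close> to \<open>p + 1\<close> every lag \<open>i \<le> p\<close> gains the one pair \<open>(p + 1 - i, p + 1)\<close>.
\<close>

lemma lag_form_by_lags:
  assumes "\<rho> 0 = 1"
  shows "lag_form \<rho> p d = (\<Sum>i = 1..p. (d i)\<^sup>2) + 2 * (\<Sum>i = 1..p. \<rho> i * (\<Sum>j = 1..p - i. d j * d (j + i)))"
proof (induction p)
  case 0
  then show ?case by (simp add: lag_form_def)
next
  case (Suc p)
  have "lag_form \<rho> (Suc p) d = lag_form \<rho> p d + (d (Suc p))\<^sup>2 +
      2 * (\<Sum>i = 1..p. d i * d (Suc p) * \<rho> (Suc p - i))"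
  proof -
    have "(\<Sum>i = 1..p. d i * d (Suc p) * \<rho> (nat \<bar>int i - int (Suc p)\<bar>)) = (\<Sum>i = 1..p. d i * d (Suc p) * \<rho> (Suc p - i))"
      "(\<Sum>j = 1..p. d (Suc p) * d j * \<rho> (nat \<bar>int (Suc p) - int j\<bar>)) = (\<Sum>i = 1..p. d i * d (Suc p) * \<rho> (Suc p - i))"
      by (auto intro!: sum.cong arg_cong[where f = \<rho>] simp: mult_ac)
    then show ?thesis
      unfolding lag_form_def by (simp add: sum.distrib assms power2_eq_square)
  qed
  also have "(\<Sum>i = 1..p. d i * d (Suc p) * \<rho> (Suc p - i)) = (\<Sum>i = 1..p. \<rho> i * (d (Suc p - i) * d (Suc p)))"
    by (subst sum.atLeastAtMost_rev) (auto intro!: sum.cong)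
  also have "lag_form \<rho> p d + (d (Suc p))\<^sup>2 + 2 * (\<Sum>i = 1..p. \<rho> i * (d (Suc p - i) * d (Suc p))) =
      (\<Sum>i = 1..Suc p. (d i)\<^sup>2) +
      2 * (\<Sum>i = 1..p. \<rho> i * ((\<Sum>j = 1..p - i. d j * d (j + i)) + d (Suc p - i) * d (Suc p)))"
    unfolding Suc by (simp add: sum.distrib distrib_left)
  also have "(\<Sum>i = 1..p. \<rho> i * ((\<Sum>j = 1..p - i. d j * d (j + i)) + d (Suc p - i) * d (Suc p))) =
      (\<Sum>i = 1..p. \<rho> i * (\<Sum>j = 1..Suc p - i. d j * d (j + i)))"
    by (intro sum.cong) (auto simp: Suc_diff_le)
  finally show ?case by simp
qed

lemma lag_form_diff:
  assumes normal: "\<And>i. i \<in> {1..p} \<Longrightarrow> (\<Sum>j = 1..p. \<rho> (nat \<bar>int i - int j\<bar>) * \<alpha> j) = \<rho> i"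
  shows "lag_form \<rho> p (\<lambda>i. \<beta> i - \<alpha> i) =
    lag_form \<rho> p \<beta> - 2 * (\<Sum>i = 1..p. \<beta> i * \<rho> i) + (\<Sum>i = 1..p. \<alpha> i * \<rho> i)"
proof -
  have apply_normal: "(\<Sum>i = 1..p. \<Sum>j = 1..p. c i * \<alpha> j * \<rho> (nat \<bar>int i - int j\<bar>)) = (\<Sum>i = 1..p. c i * \<rho> i)" for c
  proof (intro sum.cong refl)
    fix i assume "i \<in> {1..p}"
    then show "(\<Sum>j = 1..p. c i * \<alpha> j * \<rho> (nat \<bar>int i - int j\<bar>)) = c i * \<rho> i"
      by (subst normal[symmetric]) (simp_all add: sum_distrib_left mult_ac)
  qed
  have swapped: "(\<Sum>i = 1..p. \<Sum>j = 1..p. \<alpha> i * \<beta> j * \<rho> (nat \<bar>int i - int j\<bar>)) = (\<Sum>i = 1..p. \<beta> i * \<rho> i)"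
    by (subst sum.swap, subst apply_normal[symmetric]) (simp add: abs_minus_commute mult_ac)
  have "lag_form \<rho> p (\<lambda>i. \<beta> i - \<alpha> i) = lag_form \<rho> p \<beta> -
      (\<Sum>i = 1..p. \<Sum>j = 1..p. \<beta> i * \<alpha> j * \<rho> (nat \<bar>int i - int j\<bar>)) -
      (\<Sum>i = 1..p. \<Sum>j = 1..p. \<alpha> i * \<beta> j * \<rho> (nat \<bar>int i - int j\<bar>)) +
      (\<Sum>i = 1..p. \<Sum>j = 1..p. \<alpha> i * \<alpha> j * \<rho> (nat \<bar>int i - int j\<bar>))"
    unfolding lag_form_def sum_subtractf[symmetric] sum.distrib[symmetric]
    by (intro sum.cong refl) (simp add: algebra_simps)
  then show ?thesis unfolding swapped apply_normal by simp
qed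

text \<open>
  A solution of the normal equations \<open>normal\<close> is the centre of the square: by them the
  terms linear in \<open>\<beta> - \<alpha>\<close> cancel.
\<close>

lemma prediction_error_form_completed_square:
  assumes "\<rho> 0 = 1"
    and normal: "\<And>i. i \<in> {1..p} \<Longrightarrow> (\<Sum>j = 1..p. \<rho> (nat \<bar>int i - int j\<bar>) * \<alpha> j) = \<rho> i"
  shows "toeplitz_form \<rho> p (prediction_error_coeffs \<beta>) =
    toeplitz_form \<rho> p (prediction_error_coeffs \<alpha>) + lag_form \<rho> p (\<lambda>i. \<beta> i - \<alpha> i)"
proof -
  have "lag_form \<rho> p (\<lambda>_. 0) = 0" by (simp add: lag_form_def)
  then have "lag_form \<rho> p \<alpha> = (\<Sum>i = 1..p. \<alpha> i * \<rho> i)"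
    using lag_form_diff[OF normal, of \<alpha>] by simp
  then show ?thesis
    unfolding toeplitz_form_prediction_error[where \<rho> = \<rho>, OF assms(1)]
    using lag_form_diff[OF normal, of \<beta>] by simp
qed

lemma arg_min_prediction_error_iff:
  assumes "\<rho> 0 = 1"
    and pos: "\<And>d i. i \<in> {1..p} \<Longrightarrow> d i \<noteq> 0 \<Longrightarrow> 0 < lag_form \<rho> p d"
    and normal: "\<And>i. i \<in> {1..p} \<Longrightarrow> (\<Sum>j = 1..p. \<rho> (nat \<bar>int i - int j\<bar>) * \<alpha> j) = \<rho> i"
  shows "is_arg_min (\<lambda>\<beta>. toeplitz_form \<rho> p (prediction_error_coeffs \<beta>)) (\<lambda>_. True) \<beta> \<longleftrightarrow>
    (\<forall>i\<in>{1..p}. \<beta> i = \<alpha> i)"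
proof -
  let ?q = "\<lambda>\<beta>. toeplitz_form \<rho> p (prediction_error_coeffs \<beta>)"
  note square = prediction_error_form_completed_square[where \<rho> = \<rho> and \<alpha> = \<alpha>, OF assms(1) normal]
  have zero: "lag_form \<rho> p d = 0" if "\<And>i. i \<in> {1..p} \<Longrightarrow> d i = 0" for d
    using that by (simp add: lag_form_def)
  have nonneg: "0 \<le> lag_form \<rho> p d" for d
    using pos[of _ d] zero[of d] by (metis less_imp_le order_refl)
  show ?thesis
  proof
    assume "is_arg_min ?q (\<lambda>_. True) \<beta>"
    then have "\<not> ?q \<alpha> < ?q \<beta>" unfolding is_arg_min_def by blast
    then have "\<not> 0 < lag_form \<rho> p (\<lambda>i. \<beta> i - \<alpha> i)" using square[of \<beta>] by simp
    then show "\<forall>i\<in>{1..p}. \<beta> i = \<alpha> i"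
      using pos[of _ "\<lambda>i. \<beta> i - \<alpha> i"] by (metis right_minus_eq)
  next
    assume "\<forall>i\<in>{1..p}. \<beta> i = \<alpha> i"
    then have "lag_form \<rho> p (\<lambda>i. \<beta> i - \<alpha> i) = 0" by (intro zero) simp
    then have "?q \<beta> \<le> ?q \<beta>'" for \<beta>' using square[of \<beta>] square[of \<beta>'] nonneg by simp
    then show "is_arg_min ?q (\<lambda>_. True) \<beta>" unfolding is_arg_min_def by (simp add: not_less)
  qed
qed

section \<open>The normal equations in matrix form\<close>

lemma autocorrelation_mat_carrier [simp]: "autocorrelation_mat \<rho> p \<in> carrier_mat p p"
  by (simp add: autocorrelation_mat_def)

lemma vec_from_1_carrier [simp]: "vec_from_1 \<beta> p \<in> carrier_vec p"
  by (simp add: vec_from_1_def)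

lemma autocorrelation_mat_mult_vec_from_1:
  assumes "\<rho> 0 = 1"
  shows "autocorrelation_mat \<rho> p *\<^sub>v vec_from_1 \<beta> p =
    vec_from_1 (\<lambda>i. \<Sum>j = 1..p. \<rho> (nat \<bar>int i - int j\<bar>) * \<beta> j) p"
  by (rule eq_vecI)
    (auto simp: autocorrelation_mat_def vec_from_1_def scalar_prod_def sum.atLeast1_atMost_eq
      atLeast0LessThan assms intro!: sum.cong)

lemma vec_from_1_eq_iff: "vec_from_1 \<alpha> p = vec_from_1 \<beta> p \<longleftrightarrow> (\<forall>i\<in>{1..p}. \<alpha> i = \<beta> i)"
proof
  assume eq: "vec_from_1 \<alpha> p = vec_from_1 \<beta> p"
  show "\<forall>i\<in>{1..p}. \<alpha> i = \<beta> i"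
  proof
    fix i assume "i \<in> {1..p}"
    then show "\<alpha> i = \<beta> i" using arg_cong[OF eq, of "\<lambda>v. vec_index v (i - 1)"]
      by (cases i) (auto simp: vec_from_1_def)
  qed
qed (auto simp: vec_from_1_def)

lemma vec_from_1_surj:
  assumes "v \<in> carrier_vec p"
  shows "vec_from_1 (\<lambda>i. vec_index v (i - 1)) p = v"
  using assms by (intro eq_vecI) (auto simp: vec_from_1_def)

text \<open>
  A nonzero vector in the kernel would make the positive definite form vanish.
\<close>

lemma autocorrelation_mat_invertible:
  assumes "\<rho> 0 = 1"
    and pos: "\<And>d i. i \<in> {1..p} \<Longrightarrow> d i \<noteq> 0 \<Longrightarrow> 0 < lag_form \<rho> p d"
  obtains R where "R \<in> carrier_mat p p" "autocorrelation_mat \<rho> p * R = 1\<^sub>m p" "R * autocorrelation_mat \<rho> p = 1\<^sub>m p"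
proof -
  have "det (autocorrelation_mat \<rho> p) \<noteq> 0"
  proof
    assume "det (autocorrelation_mat \<rho> p) = 0"
    then obtain v where v: "v \<in> carrier_vec p" "v \<noteq> 0\<^sub>v p" "autocorrelation_mat \<rho> p *\<^sub>v v = 0\<^sub>v p"
      using det_0_iff_vec_prod_zero[OF autocorrelation_mat_carrier] by blast
    define d where "d = (\<lambda>i. vec_index v (i - 1))"
    have v_d: "vec_from_1 d p = v" unfolding d_def by (rule vec_from_1_surj[OF v(1)])
    have zero_d: "vec_from_1 (\<lambda>_. 0) p = 0\<^sub>v p" by (auto simp: vec_from_1_def)
    have "\<forall>i\<in>{1..p}. (\<Sum>j = 1..p. \<rho> (nat \<bar>int i - int j\<bar>) * d j) = 0"
      using v(3) unfolding v_d[symmetric] autocorrelation_mat_mult_vec_from_1[where \<rho> = \<rho>, OF assms(1)] zero_d[symmetric]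
        vec_from_1_eq_iff .
    moreover have "lag_form \<rho> p d = (\<Sum>i = 1..p. d i * (\<Sum>j = 1..p. \<rho> (nat \<bar>int i - int j\<bar>) * d j))"
      by (simp add: lag_form_def sum_distrib_left mult_ac)
    ultimately have "lag_form \<rho> p d = 0" by simp
    moreover obtain i where "i \<in> {1..p}" "d i \<noteq> 0"
      using v(2) unfolding v_d[symmetric] zero_d[symmetric] vec_from_1_eq_iff by blast
    ultimately show False using pos by fastforce
  qed
  from det_non_zero_imp_unit[OF autocorrelation_mat_carrier this, of "()"]
  show ?thesis using that unfolding Units_def by (auto simp: ring_mat_simps)
qed

section \<open>Autoregressive fits to a CSA process\<close>

theorem theorem4:
  fixes a b \<sigma> :: real and p :: nat and t :: int
    and P :: "'w measure" and A :: "nat \<Rightarrow> 'w \<Rightarrow> real"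
    and e X :: "nat \<Rightarrow> int \<Rightarrow> 'w \<Rightarrow> real"
    and M :: "'v measure" and x :: "int \<Rightarrow> 'v \<Rightarrow> real"
  defines "\<gamma> \<equiv> \<gamma>_CSA a b"
  assumes "a > 0" and "b > 1" and "p \<ge> 1"
    and "CSA_process a b \<sigma> P A e X M x"
  shows "(\<exists>R. R \<in> carrier_mat p p \<and>
            inverts_mat (autocorrelation_mat \<gamma> p) R \<and> inverts_mat R (autocorrelation_mat \<gamma> p) \<and>
            (\<forall>\<alpha>. AR_fit M x p t \<alpha> \<longleftrightarrow> vec_from_1 \<alpha> p = R *\<^sub>v vec_from_1 \<gamma> p)) \<and>
         (\<forall>\<alpha>. AR_fit M x p t \<alpha> \<longrightarrow>
            \<zeta>_AR M \<sigma> x p \<alpha> t =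
              (Beta a (b - 1) / Beta a b) *
              ((1 + (\<Sum>i = 1..p. (\<alpha> i)\<^sup>2)) +
               2 * (\<Sum>i = 1..p. \<gamma> i * (- \<alpha> i + (\<Sum>j = 1..p - i. \<alpha> j * \<alpha> (j + i))))))"
proof -
  interpret P: ar1_panel P a b \<sigma> A e X using assms(5) by (simp add: CSA_process_def)
  note ab = assms(2,3)
  define V where "V = \<sigma>\<^sup>2 * (Beta a (b - 1) / Beta a b)"
  have V_pos: "0 < V"
    using P.sigma_pos beta_real_pos[of a b] beta_real_pos[of a "b - 1"] ab by (simp add: V_def)
  have \<gamma>_0: "\<gamma> 0 = 1"
    using beta_real_pos[of a "b - 1"] ab by (simp add: \<gamma>_def \<gamma>_CSA_def)
  have pos: "0 < lag_form \<gamma> p d" if "i \<in> {1..p}" "d i \<noteq> 0" for d i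
    unfolding lag_form_eq_toeplitz_form \<gamma>_def
    by (rule P.toeplitz_form_\<gamma>_CSA_pos[OF ab, of i]) (use that in auto)
  have variance: "prob_space.variance M (AR_residual x p \<alpha> t) =
      V * toeplitz_form \<gamma> p (prediction_error_coeffs \<alpha>)" for \<alpha>
    unfolding AR_residual_eq_combination V_def \<gamma>_def
    by (rule CSA_combination_variance[OF ab assms(5), of 0]) auto
  obtain R where R: "R \<in> carrier_mat p p" "autocorrelation_mat \<gamma> p * R = 1\<^sub>m p" "R * autocorrelation_mat \<gamma> p = 1\<^sub>m p"
    by (rule autocorrelation_mat_invertible[where \<rho> = \<gamma> and p = p, OF \<gamma>_0]) (use pos in blast)+
  define \<alpha> where "\<alpha> = (\<lambda>i. vec_index (R *\<^sub>v vec_from_1 \<gamma> p) (i - 1))"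
  have \<alpha>: "vec_from_1 \<alpha> p = R *\<^sub>v vec_from_1 \<gamma> p"
    unfolding \<alpha>_def using R(1) by (intro vec_from_1_surj mult_mat_vec_carrier) auto
  have "autocorrelation_mat \<gamma> p *\<^sub>v vec_from_1 \<alpha> p = vec_from_1 \<gamma> p"
    unfolding \<alpha> using R by (simp flip: assoc_mult_mat_vec[OF autocorrelation_mat_carrier R(1) vec_from_1_carrier])
  then have normal: "(\<Sum>j = 1..p. \<gamma> (nat \<bar>int i - int j\<bar>) * \<alpha> j) = \<gamma> i" if "i \<in> {1..p}" for i
    using that unfolding autocorrelation_mat_mult_vec_from_1[where \<rho> = \<gamma>, OF \<gamma>_0] vec_from_1_eq_iff by blast
  have fit: "AR_fit M x p t \<beta> \<longleftrightarrow> vec_from_1 \<beta> p = R *\<^sub>v vec_from_1 \<gamma> p" for \<beta>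
  proof -
    have "AR_fit M x p t \<beta> \<longleftrightarrow>
        is_arg_min (\<lambda>\<beta>. toeplitz_form \<gamma> p (prediction_error_coeffs \<beta>)) (\<lambda>_. True) \<beta>"
      unfolding AR_fit_def variance is_arg_min_def using V_pos by simp
    also have "\<dots> \<longleftrightarrow> vec_from_1 \<beta> p = vec_from_1 \<alpha> p"
      unfolding vec_from_1_eq_iff by (rule arg_min_prediction_error_iff[where \<rho> = \<gamma>, OF \<gamma>_0]) (use pos normal in blast)+
    finally show ?thesis unfolding \<alpha> .
  qed
  have "\<zeta>_AR M \<sigma> x p \<beta> t = (Beta a (b - 1) / Beta a b) *
      ((1 + (\<Sum>i = 1..p. (\<beta> i)\<^sup>2)) +
       2 * (\<Sum>i = 1..p. \<gamma> i * (- \<beta> i + (\<Sum>j = 1..p - i. \<beta> j * \<beta> (j + i)))))" for \<beta>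
  proof -
    have "toeplitz_form \<gamma> p (prediction_error_coeffs \<beta>) = (1 + (\<Sum>i = 1..p. (\<beta> i)\<^sup>2)) +
        2 * (\<Sum>i = 1..p. \<gamma> i * (- \<beta> i + (\<Sum>j = 1..p - i. \<beta> j * \<beta> (j + i))))"
      unfolding toeplitz_form_prediction_error[where \<rho> = \<gamma>, OF \<gamma>_0] lag_form_by_lags[where \<rho> = \<gamma>, OF \<gamma>_0]
      by (simp add: right_diff_distrib sum_subtractf mult.commute)
    then show ?thesis
      unfolding \<zeta>_AR_def variance V_def using P.sigma_pos by simp
  qed
  moreover have "inverts_mat (autocorrelation_mat \<gamma> p) R" "inverts_mat R (autocorrelation_mat \<gamma> p)"
    using R carrier_matD(1)[OF autocorrelation_mat_carrier, of \<gamma> p] by (auto simp: inverts_mat_def)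
  ultimately show ?thesis using R(1) fit by blast
qed

end
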